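(* Let $n\ge 1$ and let $u:\mathbb{R}^n\to\mathbb{R}$ be a smooth convex function satisfying, for all $x\in\mathbb{R}^n$, $$\ln\det D^2u(x)=\frac12\,x\cdot Du(x)-u(x).$$ Suppose that at least one of the following holds: (i) there exist $\delta>0$ and $R>0$ such that $D^2u(x)\ge \dfrac{2(n-1+\delta)}{|x|^2}\,I$ for all $x\in\mathbb{R}^n$ with $|x|\ge R$; or (ii) $u$ is radially symmetric (that is, $u(x)$ depends only on $|x|$). Then $u$ is a quadratic polynomial; precisely, $$u(x)=u(0)+\frac12\langle D^2u(0)\,x,x\rangle\qquad\text{for all }x\in\mathbb{R}^n.$$
   Context: $Du$ and $D^2u$ denote the Euclidean gradient and Hessian matrix of $u$ on $\mathbb{R}^n$; $\cdot$ and $\langle\cdot,\cdot\rangle$ denote the Euclidean inner product; $I$ is the $n\times n$ identity matrix; matrix inequalities between symmetric matrices are in the sense of quadratic forms ($A\ge B$ means $A-B$ is positive semidefinite). Smooth means $C^\infty$. That $u$ solves the equation includes that $\det D^2u(x)>0$ everywhere, so that the logarithm is defined. *)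

theory Defs
  imports "HOL-Analysis.Analysis"
begin

definition partial_deriv :: "'n::finite \<Rightarrow> (real^'n \<Rightarrow> real) \<Rightarrow> real^'n \<Rightarrow> real" where
  "partial_deriv i f x = frechet_derivative f (at x) (axis i 1)"

(* Class C^k on the whole space.  Since frechet_derivative is a choice operator,
   differentiability has to be demanded explicitly at every stage. *)
primrec C_k :: "nat \<Rightarrow> (real^'n::finite \<Rightarrow> real) \<Rightarrow> bool" where
  "C_k 0 f \<longleftrightarrow> continuous_on UNIV f"
| "C_k (Suc k) f \<longleftrightarrow> (\<forall>x. f differentiable (at x)) \<and> (\<forall>i. C_k k (partial_deriv i f))"

definition smooth :: "(real^'n::finite \<Rightarrow> real) \<Rightarrow> bool" where
  "smooth f \<longleftrightarrow> (\<forall>k. C_k k f)"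

definition gradient :: "(real^'n::finite \<Rightarrow> real) \<Rightarrow> real^'n \<Rightarrow> real^'n" where
  "gradient f x = (\<chi> i. partial_deriv i f x)"

definition hessian :: "(real^'n::finite \<Rightarrow> real) \<Rightarrow> real^'n \<Rightarrow> real^'n^'n" where
  "hessian f x = (\<chi> i j. partial_deriv j (partial_deriv i f) x)"

definition positive_semidefinite :: "real^'n::finite^'n \<Rightarrow> bool" where
  "positive_semidefinite A \<longleftrightarrow> transpose A = A \<and> (\<forall>v. 0 \<le> (A *v v) \<bullet> v)"

definition matrix_ge :: "real^'n::finite^'n \<Rightarrow> real^'n^'n \<Rightarrow> bool" where
  "matrix_ge A B \<longleftrightarrow> positive_semidefinite (A - B)"

definition radially_symmetric :: "(real^'n::finite \<Rightarrow> real) \<Rightarrow> bool" where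
  "radially_symmetric f \<longleftrightarrow> (\<forall>x y. norm x = norm y \<longrightarrow> f x = f y)"

lemma GDERIV_gradient:
  assumes "f differentiable (at x)"
  shows "GDERIV f x :> gradient f x"
proof -
  let ?D = "frechet_derivative f (at x)"
  have D: "(f has_derivative ?D) (at x)"
    using assms by (simp add: frechet_derivative_works)
  then have lin: "linear ?D" by (rule has_derivative_linear)
  have "?D h = h \<bullet> gradient f x" for h
  proof -
    have "?D h = ?D (\<Sum>i\<in>UNIV. (h $ i) *\<^sub>R axis i 1)"
      using basis_expansion[of h] by (simp add: scalar_mult_eq_scaleR)
    also have "\<dots> = (\<Sum>i\<in>UNIV. h $ i * ?D (axis i 1))"
      by (simp add: linear_sum[OF lin] linear_scale[OF lin])
    finally show ?thesis by (simp add: inner_vec_def gradient_def partial_deriv_def)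
  qed
  then have "?D = (\<lambda>h. h \<bullet> gradient f x)" by blast
  with D show ?thesis by (simp add: gderiv_def)
qed

lemma hessian_eq_jacobian_gradient:
  assumes "\<And>i. partial_deriv i f differentiable (at x)"
  shows "hessian f x = jacobian (gradient f) (at x)"
proof -
  have "(gradient f has_derivative
      (\<lambda>h. \<chi> i. frechet_derivative (partial_deriv i f) (at x) h)) (at x)"
  proof (subst has_derivative_componentwise_within, rule ballI)
    fix b :: "real^'a" assume "b \<in> Basis"
    then obtain i where "b = axis i 1" by (auto simp: Basis_vec_def)
    then show "((\<lambda>x. gradient f x \<bullet> b) has_derivative
        (\<lambda>h. (\<chi> i. frechet_derivative (partial_deriv i f) (at x) h) \<bullet> b)) (at x)"
      using assms[of i] by (simp add: inner_axis gradient_def frechet_derivative_works)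
  qed
  from frechet_derivative_at[OF this, symmetric] show ?thesis
    by (simp add: jacobian_def matrix_def hessian_def partial_deriv_def vec_eq_iff)
qed

end

theory Submission
  imports Defs "HOL-Real_Asymp.Real_Asymp"
begin

text \<open>Put \<open>\<phi> = ln det D\<^sup>2u = 1/2 x \<bullet> Du - u\<close> and let \<open>L f = tr ((D\<^sup>2u)\<inverse> D\<^sup>2f) - 1/2 x \<bullet> Df\<close>.  Differentiating
  the equation twice gives \<open>L \<phi> = 0\<close>.  Under the Hessian bound, \<open>|x|\<close> is a strict supersolution
  outside a ball that dominates the logarithmic lower bound for \<open>\<phi>\<close>, so \<open>\<phi>\<close> attains its global
  minimum and is constant by the strong maximum principle.  In the radial case \<open>\<phi>\<close> is constant on
  spheres, so on every ball its minimum or its maximum is attained inside.  Once \<open>\<phi>\<close> is constant,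
  \<open>D\<^sup>2u(x) x = Du(x)\<close>, hence \<open>Du\<close> is homogeneous of degree one and, being differentiable at the
  origin, linear.\<close>

section \<open>Calculus of smooth functions\<close>

text \<open>The identity for L \<phi> hinges on the factor 1/2: two derivatives of 1/2 x . Du - u
  leave only 1/2 D^3u(x, ., .), and the trace of D^3u(x, ., .) against the inverse Hessian is the
  derivative of ln det D^2u along x. As L has no term of order zero, -\<phi> obeys the same
  equation, so maxima need no separate theory. The obstacle is the lack of compactness: the inverse
  Hessian has no uniform bound on the whole space and \<phi> need not attain its infimum. The strong
  principle therefore uses ellipticity on small balls only, and infinity is handled by a barrier
  with an arbitrarily small factor \<epsilon>; letting \<epsilon> tend to 0 leaves the bound of
  \<phi> by its minimum over a fixed ball. Both barriers, the local and the global one, are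
  functions of |x - y|^2 / 2 and go through one comparison inequality.\<close>

lemma smooth_partial_deriv: "smooth f \<Longrightarrow> smooth (partial_deriv i f)"
  unfolding smooth_def by (metis C_k.simps(2))

lemma smooth_differentiable: "smooth f \<Longrightarrow> f differentiable (at x)"
  unfolding smooth_def by (metis C_k.simps(2))

lemma smooth_continuous_on: "smooth f \<Longrightarrow> continuous_on S f"
  unfolding smooth_def by (metis C_k.simps(1) continuous_on_subset subset_UNIV)

lemma continuous_on_gradient: "smooth f \<Longrightarrow> continuous_on S (gradient f)"
  unfolding gradient_def
  by (intro continuous_intros smooth_continuous_on smooth_partial_deriv)

lemma continuous_on_hessian: "smooth f \<Longrightarrow> continuous_on S (hessian f)"
  unfolding hessian_def
  by (intro continuous_intros smooth_continuous_on smooth_partial_deriv)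

lemma smooth_line_derivative:
  fixes f :: "real^'n::finite \<Rightarrow> real"
  assumes "smooth f"
  shows "((\<lambda>t. f (x + t *\<^sub>R v)) has_real_derivative v \<bullet> gradient f (x + t *\<^sub>R v)) (at t)"
proof -
  have f: "(f has_derivative (\<lambda>h. h \<bullet> gradient f (x + t *\<^sub>R v))) (at (x + t *\<^sub>R v))"
    using GDERIV_gradient[OF smooth_differentiable[OF assms]] by (simp add: gderiv_def)
  have g: "((\<lambda>t. x + t *\<^sub>R v) has_derivative (\<lambda>s. s *\<^sub>R v)) (at t)"
    by (auto intro!: derivative_eq_intros)
  show ?thesis
    using has_derivative_compose[OF g f] by (simp add: has_field_derivative_def mult_commute_abs)
qed

lemma axis_inner_gradient: "axis i 1 \<bullet> gradient f x = partial_deriv i f x"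
  by (simp add: inner_axis' gradient_def)

text \<open>The mean value theorem is applied to a difference of two values of \<open>f\<close>
  along axis \<open>i\<close>, then to \<open>partial_deriv i f\<close> along axis \<open>j\<close>.
  The left side is symmetric in \<open>i\<close> and \<open>j\<close>, the right side is not; this
  yields the symmetry of second derivatives.\<close>

lemma mixed_difference_quotient:
  fixes f :: "real^'n::finite \<Rightarrow> real"
  assumes f: "smooth f" and h: "0 < h"
  obtains s t where "0 < s" "s < h" "0 < t" "t < h"
    "f (x + h *\<^sub>R axis i 1 + h *\<^sub>R axis j 1) - f (x + h *\<^sub>R axis i 1) - f (x + h *\<^sub>R axis j 1) + f x
      = h\<^sup>2 * partial_deriv j (partial_deriv i f) (x + s *\<^sub>R axis i 1 + t *\<^sub>R axis j 1)"
proof -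
  let ?a = "axis i 1 :: real^'n" and ?b = "axis j 1 :: real^'n"
  define G where "G s = f ((x + h *\<^sub>R ?b) + s *\<^sub>R ?a) - f (x + s *\<^sub>R ?a)" for s
  have G: "(G has_real_derivative
      partial_deriv i f ((x + h *\<^sub>R ?b) + s *\<^sub>R ?a) - partial_deriv i f (x + s *\<^sub>R ?a)) (at s)" for s
    unfolding G_def axis_inner_gradient[symmetric]
    by (intro DERIV_diff smooth_line_derivative f)
  obtain s where s: "0 < s" "s < h" and Gs: "G h - G 0 = (h - 0) *
      (partial_deriv i f ((x + h *\<^sub>R ?b) + s *\<^sub>R ?a) - partial_deriv i f (x + s *\<^sub>R ?a))"
    using MVT2[OF h G] by blast
  have K: "((\<lambda>t. partial_deriv i f ((x + s *\<^sub>R ?a) + t *\<^sub>R ?b)) has_real_derivative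
      partial_deriv j (partial_deriv i f) ((x + s *\<^sub>R ?a) + t *\<^sub>R ?b)) (at t)" for t
    unfolding axis_inner_gradient[symmetric, of j]
    by (intro smooth_line_derivative smooth_partial_deriv f)
  obtain t where t: "0 < t" "t < h" and
    Ks: "partial_deriv i f ((x + s *\<^sub>R ?a) + h *\<^sub>R ?b) - partial_deriv i f ((x + s *\<^sub>R ?a) + 0 *\<^sub>R ?b)
      = (h - 0) * partial_deriv j (partial_deriv i f) ((x + s *\<^sub>R ?a) + t *\<^sub>R ?b)"
    using MVT2[OF h K] by blast
  have "G h - G 0 = h\<^sup>2 * partial_deriv j (partial_deriv i f) (x + s *\<^sub>R ?a + t *\<^sub>R ?b)"
    using Gs Ks by (simp add: power2_eq_square add.assoc add.commute[of "h *\<^sub>R ?b"])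
  then show ?thesis
    using s t by (intro that[of s t]) (auto simp: G_def algebra_simps)
qed

lemma partial_deriv_commute:
  fixes f :: "real^'n::finite \<Rightarrow> real"
  assumes f: "smooth f"
  shows "partial_deriv j (partial_deriv i f) x = partial_deriv i (partial_deriv j f) x"
proof (rule ccontr)
  let ?a = "axis i 1 :: real^'n" and ?b = "axis j 1 :: real^'n"
  let ?P = "partial_deriv j (partial_deriv i f)" and ?Q = "partial_deriv i (partial_deriv j f)"
  assume ne: "?P x \<noteq> ?Q x"
  define e where "e = \<bar>?P x - ?Q x\<bar> / 2"
  have e: "e > 0" using ne by (simp add: e_def)
  have cont: "isCont ?P x" "isCont ?Q x"
    using smooth_continuous_on[of _ UNIV] f
    by (auto simp: continuous_on_eq_continuous_at intro!: smooth_partial_deriv)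
  obtain d1 where d1: "d1 > 0" "\<And>y. dist y x < d1 \<Longrightarrow> dist (?P y) (?P x) < e"
    using cont(1) e unfolding continuous_at_eps_delta by (metis dist_norm)
  obtain d2 where d2: "d2 > 0" "\<And>y. dist y x < d2 \<Longrightarrow> dist (?Q y) (?Q x) < e"
    using cont(2) e unfolding continuous_at_eps_delta by (metis dist_norm)
  \<comment> \<open>The intermediate points lie less than \<open>h\<close> away along each of two
    unit vectors, hence less than 2 \<open>h\<close> from \<open>x\<close>.\<close>
  define h where "h = min d1 d2 / 2"
  have h: "h > 0" using d1 d2 by (simp add: h_def)
  obtain s t where st: "0 < s" "s < h" "0 < t" "t < h"
    "f (x + h *\<^sub>R ?a + h *\<^sub>R ?b) - f (x + h *\<^sub>R ?a) - f (x + h *\<^sub>R ?b) + f x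
      = h\<^sup>2 * ?P (x + s *\<^sub>R ?a + t *\<^sub>R ?b)"
    by (rule mixed_difference_quotient[OF f h])
  obtain s' t' where st': "0 < s'" "s' < h" "0 < t'" "t' < h"
    "f (x + h *\<^sub>R ?b + h *\<^sub>R ?a) - f (x + h *\<^sub>R ?b) - f (x + h *\<^sub>R ?a) + f x
      = h\<^sup>2 * ?Q (x + s' *\<^sub>R ?b + t' *\<^sub>R ?a)"
    by (rule mixed_difference_quotient[OF f h])
  have eq: "?P (x + s *\<^sub>R ?a + t *\<^sub>R ?b) = ?Q (x + s' *\<^sub>R ?b + t' *\<^sub>R ?a)"
    using st(5) st'(5) h by (simp add: algebra_simps)
  have close: "dist (x + r *\<^sub>R u + r' *\<^sub>R v) x < min d1 d2"
    if "0 < r" "r < h" "0 < r'" "r' < h" "norm u = 1" "norm v = 1" for r r' and u v :: "real^'n"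
  proof -
    have "dist (x + r *\<^sub>R u + r' *\<^sub>R v) x = norm (r *\<^sub>R u + r' *\<^sub>R v)"
      by (simp add: dist_norm algebra_simps)
    also have "\<dots> \<le> r + r'"
      using norm_triangle_ineq[of "r *\<^sub>R u" "r' *\<^sub>R v"] that by simp
    also have "\<dots> < min d1 d2" using that by (simp add: h_def)
    finally show ?thesis .
  qed
  have "dist (?P (x + s *\<^sub>R ?a + t *\<^sub>R ?b)) (?P x) < e"
    using close[of s t ?a ?b] st by (intro d1) auto
  moreover have "dist (?Q (x + s' *\<^sub>R ?b + t' *\<^sub>R ?a)) (?Q x) < e"
    using close[of s' t' ?b ?a] st' by (intro d2) auto
  ultimately show False
    using eq by (simp add: e_def dist_real_def abs_if split: if_splits)
qed

lemma transpose_hessian: "smooth f \<Longrightarrow> transpose (hessian f x) = hessian f x"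
  by (simp add: vec_eq_iff transpose_def hessian_def partial_deriv_commute)

lemma gradient_line_derivative:
  fixes f :: "real^'n::finite \<Rightarrow> real"
  assumes f: "smooth f"
  shows "((\<lambda>t. w \<bullet> gradient f (x + t *\<^sub>R v)) has_real_derivative
      w \<bullet> (hessian f (x + t *\<^sub>R v) *v v)) (at t)"
proof -
  have "((\<lambda>t. \<Sum>i\<in>UNIV. w $ i * partial_deriv i f (x + t *\<^sub>R v)) has_real_derivative
      (\<Sum>i\<in>UNIV. w $ i * (v \<bullet> gradient (partial_deriv i f) (x + t *\<^sub>R v)))) (at t)"
    by (intro DERIV_sum DERIV_cmult smooth_line_derivative smooth_partial_deriv f)
  moreover have "(\<Sum>i\<in>UNIV. w $ i * (v \<bullet> gradient (partial_deriv i f) (x + t *\<^sub>R v)))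
      = w \<bullet> (hessian f (x + t *\<^sub>R v) *v v)"
    by (simp add: inner_vec_def gradient_def hessian_def matrix_vector_mult_def mult.commute)
  ultimately show ?thesis
    by (simp add: inner_vec_def gradient_def)
qed

text \<open>If \<open>l\<close> were negative, \<open>g'\<close> would be negative just to the right
  of 0, and the mean value theorem would put \<open>g\<close> below its minimum. Differentiability
  of \<open>g'\<close> at 0 alone suffices.\<close>

lemma second_derivative_test_nonneg:
  fixes g g' :: "real \<Rightarrow> real"
  assumes d: "d > 0" and min: "\<And>t. \<bar>t\<bar> < d \<Longrightarrow> g 0 \<le> g t"
    and g: "\<And>t. \<bar>t\<bar> < d \<Longrightarrow> (g has_real_derivative g' t) (at t)"
    and g': "(g' has_real_derivative l) (at 0)"
  shows "g' 0 = 0" "0 \<le> l"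
proof -
  show z: "g' 0 = 0"
    using DERIV_local_min[OF g d, of 0] min d by auto
  show "0 \<le> l"
  proof (rule ccontr)
    assume "\<not> 0 \<le> l"
    then obtain k where k: "k > 0" "\<And>h. 0 < h \<Longrightarrow> h < k \<Longrightarrow> g' (0 + h) < g' 0"
      using DERIV_neg_dec_right[OF g'] by (meson not_le)
    define h where "h = min d k / 2"
    have h: "0 < h" "h < d" "h < k" using d k by (auto simp: h_def)
    obtain s where "0 < s" "s < h" "g h - g 0 = (h - 0) * g' s"
      using MVT2[OF h(1), of g g'] g h by auto
    moreover have "g' s < 0" using k(2)[of s] \<open>0 < s\<close> \<open>s < h\<close> h z by simp
    ultimately have "g h < g 0" using h by (smt (verit) mult_pos_neg)
    then show False using min[of h] h by auto
  qed
qed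

section \<open>Frames adapted to a positive definite matrix\<close>

definition positive_definite :: "real^'n::finite^'n \<Rightarrow> bool" where
  "positive_definite A \<longleftrightarrow> transpose A = A \<and> (\<forall>v. v \<noteq> 0 \<longrightarrow> 0 < v \<bullet> (A *v v))"

text \<open>Orthonormality is meant for the inner product v . Aw. With the vectors as columns of E
  this reads E^T A E = I, so E E^T plays the role of the inverse of A.\<close>

definition orthonormal_frame :: "real^'n::finite^'n \<Rightarrow> ('n \<Rightarrow> real^'n) \<Rightarrow> bool" where
  "orthonormal_frame A e \<longleftrightarrow> (\<forall>a b. e a \<bullet> (A *v e b) = (if a = b then 1 else 0))"

lemma symmetric_matrix_inner:
  fixes A :: "real^'n::finite^'n"
  assumes "transpose A = A"
  shows "v \<bullet> (A *v w) = w \<bullet> (A *v v)"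
  by (metis assms dot_lmul_matrix inner_commute transpose_matrix_vector)

lemma positive_definite_normalize:
  assumes "positive_definite A" "q \<noteq> 0"
  defines "c \<equiv> 1 / sqrt (q \<bullet> (A *v q))"
  shows "(c *\<^sub>R q) \<bullet> (A *v (c *\<^sub>R q)) = 1"
proof -
  have "0 < q \<bullet> (A *v q)" using assms by (simp add: positive_definite_def)
  then show ?thesis
    by (simp add: c_def matrix_vector_mult_scaleR)
qed

text \<open>Gram-Schmidt for the inner product of \<open>A\<close>, started at \<open>q\<close>. The
  prescribed direction matters because the barriers have a distinguished radial direction.\<close>

lemma orthonormal_frame_exists:
  fixes A :: "real^'n::finite^'n"
  assumes A: "positive_definite A" and q: "q \<noteq> 0"
  obtains e where "orthonormal_frame A e" "e i0 = (1 / sqrt (q \<bullet> (A *v q))) *\<^sub>R q"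
proof -
  let ?c = "1 / sqrt (q \<bullet> (A *v q))"
  have sym: "v \<bullet> (A *v w) = w \<bullet> (A *v v)" for v w
    using A symmetric_matrix_inner by (auto simp: positive_definite_def)
  have "\<exists>e. e i0 = ?c *\<^sub>R q \<and> (\<forall>a\<in>insert i0 I. \<forall>b\<in>insert i0 I. e a \<bullet> (A *v e b) = (if a = b then 1 else 0))"
    if "finite I" "i0 \<notin> I" for I :: "'n set"
    using that
  proof (induction I)
    case empty
    show ?case
      using positive_definite_normalize[OF A q] by (intro exI[of _ "\<lambda>_. ?c *\<^sub>R q"]) auto
  next
    case (insert i I)
    then obtain e where e: "e i0 = ?c *\<^sub>R q"
      "\<And>a b. a \<in> insert i0 I \<Longrightarrow> b \<in> insert i0 I \<Longrightarrow> e a \<bullet> (A *v e b) = (if a = b then 1 else 0)"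
      by (metis insertCI)
    let ?J = "insert i0 I"
    have iJ: "i \<notin> ?J" "finite ?J" using insert by auto
    have "dim (span (e ` ?J)) \<le> card ?J"
      using dim_le_card'[of "e ` ?J"] card_image_le[OF iJ(2), of e] iJ(2) by (auto simp: dim_span)
    also have "\<dots> < CARD('n)"
      using iJ by (intro psubset_card_mono) auto
    finally have "span (e ` ?J) \<noteq> UNIV"
      by (metis dim_UNIV DIM_cart DIM_real mult.right_neutral less_irrefl dim_span)
    \<comment> \<open>Fewer than n vectors have been built, so some \<open>v\<close> lies outside
      their span; subtracting its projection leaves a nonzero vector orthogonal to them for
      \<open>A\<close>.\<close>
    then obtain v where v: "v \<notin> span (e ` ?J)" by blast
    define w where "w = v - (\<Sum>a\<in>?J. (v \<bullet> (A *v e a)) *\<^sub>R e a)"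
    have "(\<Sum>a\<in>?J. (v \<bullet> (A *v e a)) *\<^sub>R e a) \<in> span (e ` ?J)"
      by (intro span_sum span_scale span_base) auto
    then have w0: "w \<noteq> 0" using v by (auto simp: w_def)
    have wJ: "w \<bullet> (A *v e b) = 0" if b: "b \<in> ?J" for b
    proof -
      have "(\<Sum>a\<in>?J. (v \<bullet> (A *v e a)) *\<^sub>R e a) \<bullet> (A *v e b)
          = (\<Sum>a\<in>?J. if a = b then v \<bullet> (A *v e a) else 0)"
        unfolding inner_sum_left by (rule sum.cong) (auto simp: e(2)[OF _ b])
      also have "\<dots> = v \<bullet> (A *v e b)"
        using b iJ(2) by (subst sum.delta) auto
      finally show ?thesis by (simp add: w_def inner_diff_left)
    qed
    define z where "z = (1 / sqrt (w \<bullet> (A *v w))) *\<^sub>R w"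
    have zz: "z \<bullet> (A *v z) = 1"
      unfolding z_def by (rule positive_definite_normalize[OF A w0])
    have zJ: "z \<bullet> (A *v e b) = 0" "e b \<bullet> (A *v z) = 0" if "b \<in> ?J" for b
      using wJ[OF that] sym[of "e b" z] by (auto simp: z_def)
    show ?case
    proof (intro exI[of _ "e(i := z)"] conjI ballI)
      show "(e(i := z)) i0 = ?c *\<^sub>R q" using e(1) iJ by auto
    next
      fix a b assume "a \<in> insert i0 (insert i I)" "b \<in> insert i0 (insert i I)"
      then have ab: "a = i \<or> a \<in> ?J" "b = i \<or> b \<in> ?J" by auto
      show "(e(i := z)) a \<bullet> (A *v (e(i := z)) b) = (if a = b then 1 else 0)"
      proof (cases "a = i")
        case True
        then show ?thesis using zz zJ[of b] ab by (cases "b = i") auto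
      next
        case False
        then have "a \<in> ?J" using ab by auto
        then show ?thesis using False zJ[of a] e(2)[of a b] ab by (cases "b = i") auto
      qed
    qed
  qed
  from this[of "UNIV - {i0}"] show ?thesis
    using that by (auto simp: orthonormal_frame_def insert_absorb)
qed

lemma orthonormal_frame_congruence:
  fixes A :: "real^'n::finite^'n"
  assumes "orthonormal_frame A e"
  defines "E \<equiv> (\<chi> i a. e a $ i)"
  shows "transpose E ** B ** E = (\<chi> a b. e a \<bullet> (B *v e b))"
    "transpose E ** A ** E = mat 1" "(det E)\<^sup>2 * det A = 1"
proof -
  have gen: "transpose E ** C ** E = (\<chi> a b. e a \<bullet> (C *v e b))" for C
  proof (simp only: vec_eq_iff, intro allI)
    fix a b
    have "(transpose E ** C ** E) $ a $ b = (transpose E ** (C ** E)) $ a $ b"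
      by (simp add: matrix_mul_assoc)
    also have "\<dots> = (\<chi> a b. e a \<bullet> (C *v e b)) $ a $ b"
      by (simp add: matrix_matrix_mult_def transpose_def inner_vec_def matrix_vector_mult_def E_def)
    finally show "(transpose E ** C ** E) $ a $ b = (\<chi> a b. e a \<bullet> (C *v e b)) $ a $ b" .
  qed
  show "transpose E ** B ** E = (\<chi> a b. e a \<bullet> (B *v e b))" by (rule gen)
  show one: "transpose E ** A ** E = mat 1"
    using assms(1) by (simp add: gen orthonormal_frame_def mat_def)
  have "det (transpose E ** A ** E) = (det E)\<^sup>2 * det A"
    by (simp add: det_mul det_transpose power2_eq_square)
  then show "(det E)\<^sup>2 * det A = 1" by (simp add: one)
qed

section \<open>Jacobi's formula for the logarithm of a determinant\<close>

text \<open>In the Leibniz expansion a permutation other than the identity moves at least two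
  indices. Differentiating one factor leaves another off-diagonal entry of the identity matrix,
  which is 0.\<close>

lemma det_derivative_at_identity:
  fixes A :: "real \<Rightarrow> real^'n::finite^'n"
  assumes A: "\<And>i j. ((\<lambda>t. A t $ i $ j) has_real_derivative D i j) (at t)" and one: "A t = mat 1"
  shows "((\<lambda>t. det (A t)) has_real_derivative (\<Sum>i\<in>UNIV. D i i)) (at t)"
proof -
  let ?P = "{p. p permutes (UNIV :: 'n set)}"
  have "((\<lambda>t. det (A t)) has_real_derivative
      (\<Sum>p\<in>?P. of_int (sign p) * (\<Sum>i\<in>UNIV. D i (p i) * (\<Prod>k\<in>UNIV - {i}. A t $ k $ p k)))) (at t)"
    unfolding det_def
    by (intro DERIV_sum DERIV_cmult has_field_derivative_prod A)
  moreover have "(\<Sum>p\<in>?P. of_int (sign p) * (\<Sum>i\<in>UNIV. D i (p i) * (\<Prod>k\<in>UNIV - {i}. A t $ k $ p k)))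
      = (\<Sum>p\<in>?P. if p = id then (\<Sum>i\<in>UNIV. D i i) else 0)"
  proof (rule sum.cong[OF refl])
    fix p assume p: "p \<in> ?P"
    show "of_int (sign p) * (\<Sum>i\<in>UNIV. D i (p i) * (\<Prod>k\<in>UNIV - {i}. A t $ k $ p k))
      = (if p = id then (\<Sum>i\<in>UNIV. D i i) else 0)"
    proof (cases "p = id")
      case True
      then show ?thesis by (simp add: one mat_def)
    next
      case False
      have "\<exists>k. k \<noteq> i \<and> k \<noteq> p k" for i
      proof (rule ccontr)
        assume p_fix: "\<not> (\<exists>k. k \<noteq> i \<and> k \<noteq> p k)"
        have "inj p" using p by (auto dest: permutes_inj)
        then have "p i = i" using p_fix by (metis injD)
        then show False using p_fix False by (metis eq_id_iff)
      qed
      then have zero: "(\<Prod>k\<in>UNIV - {i}. A t $ k $ p k) = 0" for i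
        by (intro prod_zero) (fastforce simp: one mat_def)+
      show ?thesis
        using False by (simp only: zero mult_zero_right sum.neutral_const if_False)
    qed
  qed
  moreover have "\<dots> = (\<Sum>i\<in>UNIV. D i i)"
    by (simp add: sum.delta permutes_id[unfolded id_def[symmetric]] finite_permutations)
  ultimately show ?thesis by simp
qed

text \<open>The frame is frozen at parameter \<open>t\<close>, so congruence by its matrix E reduces
  the claim to the identity matrix and multiplies the determinant by a constant, which the
  logarithmic derivative does not see.\<close>

lemma ln_det_derivative:
  fixes H :: "real \<Rightarrow> real^'n::finite^'n"
  assumes H: "\<And>i j. ((\<lambda>t. H t $ i $ j) has_real_derivative H' $ i $ j) (at t)"
    and e: "orthonormal_frame (H t) e"
  shows "((\<lambda>t. ln (det (H t))) has_real_derivative (\<Sum>a\<in>UNIV. e a \<bullet> (H' *v e a))) (at t)"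
proof -
  define E :: "real^'n^'n" where "E = (\<chi> i a. e a $ i)"
  note E = orthonormal_frame_congruence[OF e, folded E_def]
  let ?A = "\<lambda>s. transpose E ** H s ** E"
  have entry: "((\<lambda>s. ?A s $ a $ b) has_real_derivative e a \<bullet> (H' *v e b)) (at t)" for a b
  proof -
    have "((\<lambda>s. \<Sum>i\<in>UNIV. e a $ i * (\<Sum>j\<in>UNIV. H s $ i $ j * e b $ j)) has_real_derivative
        (\<Sum>i\<in>UNIV. e a $ i * (\<Sum>j\<in>UNIV. H' $ i $ j * e b $ j))) (at t)"
      by (intro DERIV_sum DERIV_cmult DERIV_cmult_right H)
    then show ?thesis
      unfolding E(1) by (simp add: inner_vec_def matrix_vector_mult_def)
  qed
  have "((\<lambda>s. det (?A s)) has_real_derivative (\<Sum>a\<in>UNIV. e a \<bullet> (H' *v e a))) (at t)"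
    by (rule det_derivative_at_identity[OF entry E(2)])
  moreover have "det (?A s) = (det E)\<^sup>2 * det (H s)" for s
    by (simp add: det_mul det_transpose power2_eq_square)
  ultimately have d: "((\<lambda>s. (det E)\<^sup>2 * det (H s)) has_real_derivative
      (\<Sum>a\<in>UNIV. e a \<bullet> (H' *v e a))) (at t)"
    by simp
  have E0: "(det E)\<^sup>2 > 0" using E(3) by (cases "det E = 0") auto
  from DERIV_cmult[OF d, of "1 / (det E)\<^sup>2"]
  have d2: "((\<lambda>s. det (H s)) has_real_derivative
      (\<Sum>a\<in>UNIV. e a \<bullet> (H' *v e a)) / (det E)\<^sup>2) (at t)"
    using E0 by simp
  have pos: "det (H t) > 0" using E(3) E0 by (smt (verit) mult_nonneg_nonpos)
  show ?thesis
    by (rule derivative_eq_intros d2 pos refl)+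
      (use E(3) E0 pos in \<open>simp add: field_simps\<close>)
qed

section \<open>Maximum principles\<close>

lemma parallelogram_identity:
  fixes a b :: "'a::real_inner"
  shows "(norm (a + b))\<^sup>2 + (norm (a - b))\<^sup>2 = 2 * (norm a)\<^sup>2 + 2 * (norm b)\<^sup>2"
  unfolding power2_norm_eq_inner
  by (simp add: inner_diff_left inner_diff_right inner_add_left inner_add_right)

text \<open>The form is continuous and positive on the product of \<open>K\<close> with the unit
  sphere, which is compact; its extrema there extend to all \<open>v\<close> by homogeneity of
  degree two.\<close>

lemma quadratic_form_bounds:
  fixes H :: "'a::topological_space \<Rightarrow> real^'n::finite^'n"
  assumes "compact K" "K \<noteq> {}" and H: "continuous_on K H"
    and pd: "\<And>x. x \<in> K \<Longrightarrow> positive_definite (H x)"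
  obtains l L where "0 < l" "0 < L"
    "\<And>x v. x \<in> K \<Longrightarrow> l * (norm v)\<^sup>2 \<le> v \<bullet> (H x *v v)"
    "\<And>x v. x \<in> K \<Longrightarrow> v \<bullet> (H x *v v) \<le> L * (norm v)\<^sup>2"
proof -
  let ?S = "K \<times> sphere (0 :: real^'n) 1"
  let ?f = "\<lambda>(x, v). v \<bullet> (H x *v v)"
  \<comment> \<open>This only witnesses that the sphere is nonempty; the index is arbitrary.\<close>
  have "axis undefined 1 \<in> sphere (0 :: real^'n) 1" by simp
  then have S: "compact ?S" "?S \<noteq> {}"
    using assms by (auto intro!: compact_Times simp: sphere_eq_empty simp del: mem_sphere_0)
  have "continuous_on ?S (\<lambda>z. H (fst z))"
    by (rule continuous_on_compose2[OF H]) (auto intro: continuous_intros)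
  then have cont: "continuous_on ?S ?f"
    unfolding case_prod_beta inner_vec_def matrix_vector_mult_def
    by (auto intro!: continuous_intros)
  obtain z0 where z0: "z0 \<in> ?S" "\<And>z. z \<in> ?S \<Longrightarrow> ?f z0 \<le> ?f z"
    using continuous_attains_inf[OF S cont] by blast
  obtain z1 where z1: "z1 \<in> ?S" "\<And>z. z \<in> ?S \<Longrightarrow> ?f z \<le> ?f z1"
    using continuous_attains_sup[OF S cont] by blast
  have pos: "0 < ?f z" if "z \<in> ?S" for z
  proof -
    have "snd z \<noteq> 0" "fst z \<in> K" using that by auto
    then show ?thesis using pd unfolding positive_definite_def case_prod_beta by blast
  qed
  have scale: "v \<bullet> (H x *v v) = (norm v)\<^sup>2 * ?f (x, sgn v)" for x v
  proof -
    have "(norm v *\<^sub>R sgn v) \<bullet> (H x *v (norm v *\<^sub>R sgn v)) = (norm v)\<^sup>2 * ?f (x, sgn v)"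
      unfolding matrix_vector_mult_scaleR inner_scaleR_left inner_scaleR_right
      by (simp add: power2_eq_square)
    moreover have "norm v *\<^sub>R sgn v = v" by (cases "v = 0") (simp_all add: sgn_div_norm)
    ultimately show ?thesis by (simp only:)
  qed
  have bounds: "?f z0 * (norm v)\<^sup>2 \<le> v \<bullet> (H x *v v) \<and> v \<bullet> (H x *v v) \<le> ?f z1 * (norm v)\<^sup>2"
    if x: "x \<in> K" for x v
  proof (cases "v = 0")
    case False
    then have "(x, sgn v) \<in> ?S" using x by (simp add: norm_sgn)
    from z0(2)[OF this] z1(2)[OF this] show ?thesis
      unfolding scale[of v x] mult.commute[of "(norm v)\<^sup>2"]
      by (intro conjI mult_right_mono zero_le_power2)
  qed simp
  show ?thesis
    using bounds pos[OF z0(1)] pos[OF z1(1)] by (intro that[of "?f z0" "?f z1"]) auto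
qed

text \<open>The drift Laplacian \<open>L f = tr (H\<inverse> D\<^sup>2 f) - 1/2 x \<bullet> D f\<close> is expressed through frames:
  if \<open>e\<close> is orthonormal for \<open>H x\<close>, then \<open>tr ((H x)\<inverse> B) = (\<Sum>a. e a \<bullet> B (e a))\<close>.  Here
  \<open>D1 x v\<close> and \<open>D2 x v\<close> are the first and second derivative of \<open>\<phi>\<close> at \<open>x\<close> in direction \<open>v\<close>.\<close>

locale drift_harmonic =
  fixes H :: "real^'n::finite \<Rightarrow> real^'n^'n" and \<phi> :: "real^'n \<Rightarrow> real"
    and D1 D2 :: "real^'n \<Rightarrow> real^'n \<Rightarrow> real"
  assumes continuous_H: "continuous_on UNIV H"
    and positive_definite_H: "positive_definite (H x)"
    and continuous_\<phi>: "continuous_on UNIV \<phi>"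
    and first_derivative: "((\<lambda>t. \<phi> (x + t *\<^sub>R v)) has_real_derivative D1 (x + t *\<^sub>R v) v) (at t)"
    and second_derivative: "((\<lambda>t. D1 (x + t *\<^sub>R v) v) has_real_derivative D2 x v) (at 0)"
    and harmonic: "orthonormal_frame (H x) e \<Longrightarrow> (\<Sum>a\<in>UNIV. D2 x (e a)) = 1/2 * D1 x x"
begin

lemma drift_harmonic_uminus:
  "drift_harmonic H (\<lambda>x. - \<phi> x) (\<lambda>x v. - D1 x v) (\<lambda>x v. - D2 x v)"
  using continuous_H positive_definite_H continuous_\<phi> first_derivative second_derivative harmonic
  by unfold_locales (auto intro!: continuous_intros DERIV_minus simp: sum_negf)

text \<open>At a local minimum of \<open>\<phi>\<close> plus barrier all first derivatives vanish
  and all second derivatives are nonnegative. Summing over the frame and using the equation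
  eliminates \<open>\<phi>\<close>, which leaves L(barrier) >= 0 at \<open>p\<close>. The variable
  |x - y|^2 / 2 has gradient x - y and Hessian I, whence the shape of the summands.\<close>

lemma radial_comparison:
  assumes e: "orthonormal_frame (H p) e" and py: "p \<noteq> y" and r: "r > 0"
    and min: "\<And>x. x \<in> ball p r \<Longrightarrow> \<phi> p + F ((norm (p - y))\<^sup>2 / 2) \<le> \<phi> x + F ((norm (x - y))\<^sup>2 / 2)"
    and F: "\<And>s. s > 0 \<Longrightarrow> (F has_real_derivative F' s) (at s)"
    and F': "(F' has_real_derivative F'') (at ((norm (p - y))\<^sup>2 / 2))"
  shows "1/2 * F' ((norm (p - y))\<^sup>2 / 2) * (p \<bullet> (p - y))
    \<le> (\<Sum>a\<in>UNIV. F'' * (e a \<bullet> (p - y))\<^sup>2 + F' ((norm (p - y))\<^sup>2 / 2) * (norm (e a))\<^sup>2)"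
proof -
  define s where "s = (norm (p - y))\<^sup>2 / 2"
  have *: "D1 p v + F' s * (v \<bullet> (p - y)) = 0"
    "0 \<le> D2 p v + (F'' * (v \<bullet> (p - y))\<^sup>2 + F' s * (norm v)\<^sup>2)" for v
  proof -
    \<comment> \<open>This keeps \<open>p + t *\<^sub>R v\<close> inside the ball and away from
      \<open>y\<close>, where \<open>F\<close> need not be differentiable; the summand 1 covers
      \<open>v = 0\<close>.\<close>
    define d where "d = min r (norm (p - y)) / (norm v + 1)"
    have v1: "norm v + 1 > 0" using norm_ge_zero[of v] by linarith
    have d: "d > 0" using r py v1 by (simp add: d_def)
    have small: "norm (t *\<^sub>R v) < min r (norm (p - y))" if "\<bar>t\<bar> < d" for t
    proof -
      have "norm (t *\<^sub>R v) \<le> \<bar>t\<bar> * (norm v + 1)" by (simp add: mult_left_mono)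
      also have "\<dots> < d * (norm v + 1)" using that v1 by simp
      finally show ?thesis using v1 by (simp add: d_def)
    qed
    define q where "q t = (norm (p + t *\<^sub>R v - y))\<^sup>2 / 2" for t
    have q_eq: "q t = s + t * (v \<bullet> (p - y)) + t\<^sup>2 / 2 * (norm v)\<^sup>2" for t
      unfolding q_def s_def power2_norm_eq_inner
      by (simp add: inner_diff_left inner_diff_right inner_add_left inner_add_right
          inner_commute field_simps power2_eq_square)
    have q0: "q 0 = s" by (simp add: q_eq)
    have q_pos: "q t > 0" if "\<bar>t\<bar> < d" for t
    proof -
      have "p + t *\<^sub>R v - y \<noteq> 0"
      proof
        assume "p + t *\<^sub>R v - y = 0"
        then have "p - y = - (t *\<^sub>R v)" by (simp add: algebra_simps)
        then show False using small[OF that] by simp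
      qed
      then show ?thesis by (simp add: q_def)
    qed
    have dq: "(q has_real_derivative (v \<bullet> (p - y)) + t * (norm v)\<^sup>2) (at t)" for t
      unfolding q_eq[abs_def] by (auto intro!: derivative_eq_intros)
    define g where "g t = \<phi> (p + t *\<^sub>R v) + F (q t)" for t
    define g' where "g' t = D1 (p + t *\<^sub>R v) v + F' (q t) * ((v \<bullet> (p - y)) + t * (norm v)\<^sup>2)" for t
    have gmin: "g 0 \<le> g t" if "\<bar>t\<bar> < d" for t
      using min[of "p + t *\<^sub>R v"] small[OF that] by (simp add: g_def q_def dist_norm)
    have dg: "(g has_real_derivative g' t) (at t)" if "\<bar>t\<bar> < d" for t
      unfolding g_def g'_def
      by (intro DERIV_add first_derivative DERIV_chain2[OF F] dq q_pos that)
    have F'q: "(F' has_real_derivative F'') (at (q 0))" using F' by (simp add: q0 s_def)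
    have "((\<lambda>t. F' (q t)) has_real_derivative F'' * ((v \<bullet> (p - y)) + 0 * (norm v)\<^sup>2)) (at 0)"
      by (rule DERIV_chain2[OF F'q dq])
    then have "((\<lambda>t. F' (q t)) has_real_derivative F'' * (v \<bullet> (p - y))) (at 0)" by simp
    then have "((\<lambda>t. F' (q t) * ((v \<bullet> (p - y)) + t * (norm v)\<^sup>2)) has_real_derivative
        F'' * (v \<bullet> (p - y))\<^sup>2 + F' s * (norm v)\<^sup>2) (at 0)"
      by (auto intro!: derivative_eq_intros simp: q0 power2_eq_square)
    from DERIV_add[OF second_derivative this]
    have dg': "(g' has_real_derivative
        D2 p v + (F'' * (v \<bullet> (p - y))\<^sup>2 + F' s * (norm v)\<^sup>2)) (at 0)"
      by (simp add: g'_def[abs_def])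
    show "D1 p v + F' s * (v \<bullet> (p - y)) = 0"
      "0 \<le> D2 p v + (F'' * (v \<bullet> (p - y))\<^sup>2 + F' s * (norm v)\<^sup>2)"
      using second_derivative_test_nonneg[OF d gmin dg dg'] by (simp_all add: g'_def q0)
  qed
  have "0 \<le> (\<Sum>a\<in>UNIV. D2 p (e a) + (F'' * (e a \<bullet> (p - y))\<^sup>2 + F' s * (norm (e a))\<^sup>2))"
    by (intro sum_nonneg *(2))
  then have "0 \<le> 1/2 * D1 p p + (\<Sum>a\<in>UNIV. F'' * (e a \<bullet> (p - y))\<^sup>2 + F' s * (norm (e a))\<^sup>2)"
    by (simp add: sum.distrib harmonic[OF e])
  \<comment> \<open>The first-order condition in the direction \<open>p\<close> itself turns the
    drift of \<open>\<phi>\<close> into that of the barrier.\<close>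
  moreover have "1/2 * D1 p p = - (1/2 * F' s * (p \<bullet> (p - y)))"
    using *(1)[of p] by linarith
  ultimately show ?thesis
    unfolding s_def[symmetric] by linarith
qed

text \<open>Hopf's barrier \<open>- \<epsilon> exp (- \<alpha> |x - y|\<^sup>2)\<close> is a strict supersolution near \<open>z\<close> for large \<open>\<alpha>\<close>.
  Adding it to \<open>\<phi>\<close> makes the minimum over a small ball around \<open>z\<close> an interior one.\<close>

lemma no_isolated_contact:
  assumes \<rho>: "\<rho> > 0" and zy: "norm (z - y) = \<rho>" and r: "r > 0"
    and inside: "\<And>x. x \<in> cball y \<rho> \<Longrightarrow> x \<noteq> z \<Longrightarrow> \<phi> z < \<phi> x"
    and near: "\<And>x. x \<in> cball z r \<Longrightarrow> \<phi> z \<le> \<phi> x"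
  shows False
proof -
  \<comment> \<open>The bound \<rho>/2 keeps the small ball away from \<open>y\<close>, so that |x -
    y| >= \<rho>/2 on it.\<close>
  define s where "s = min r (\<rho> / 2)"
  have s: "0 < s" "s \<le> r" "s \<le> \<rho> / 2" using r \<rho> by (auto simp: s_def)
  have ball: "compact (cball z s)" "cball z s \<noteq> {}" "continuous_on (cball z s) H"
    using s continuous_on_subset[OF continuous_H] by auto
  obtain l L where l: "0 < l" and L: "0 < L"
    and lb: "\<And>x v. x \<in> cball z s \<Longrightarrow> l * (norm v)\<^sup>2 \<le> v \<bullet> (H x *v v)"
    and ub: "\<And>x v. x \<in> cball z s \<Longrightarrow> v \<bullet> (H x *v v) \<le> L * (norm v)\<^sup>2"
    using quadratic_form_bounds[OF ball positive_definite_H] by blast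
  define C where "C = (norm z + s) * (\<rho> + s)"
  have C: "C \<ge> 0" using s \<rho> by (simp add: C_def)
  \<comment> \<open>Here n/\<open>l\<close> bounds the sum of |e a|^2 and \<open>C\<close> bounds |p
    . q|. The value is chosen so that the comparison inequality becomes 1/2 p . q <= -C - 1.\<close>
  define \<alpha> where "\<alpha> = (real CARD('n) / l + C + 1) * 2 * L / \<rho>\<^sup>2"
  have \<alpha>: "\<alpha> > 0" using l L C \<rho> by (simp add: \<alpha>_def add_nonneg_pos)
  have \<alpha>_eq: "\<alpha> * \<rho>\<^sup>2 / (2 * L) = real CARD('n) / l + C + 1"
    using L \<rho> by (simp add: \<alpha>_def)
  \<comment> \<open>Only on this part of the boundary sphere is a gap \<epsilon> needed: outside
    \<open>cball y \<rho>\<close> the barrier itself is larger than at \<open>z\<close>.\<close>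
  define K where "K = sphere z s \<inter> cball y \<rho>"
  have "\<exists>\<epsilon>>0. \<forall>x\<in>K. \<phi> z + \<epsilon> < \<phi> x"
  proof (cases "K = {}")
    case True
    then show ?thesis by (intro exI[of _ 1]) auto
  next
    case False
    have K: "compact K" unfolding K_def by (intro compact_Int_closed) auto
    obtain x0 where x0: "x0 \<in> K" "\<And>x. x \<in> K \<Longrightarrow> \<phi> x0 \<le> \<phi> x"
      using continuous_attains_inf[OF K False continuous_on_subset[OF continuous_\<phi>]] by auto
    have "x0 \<noteq> z" "x0 \<in> cball y \<rho>" using x0(1) s by (auto simp: K_def)
    then have "\<phi> z < \<phi> x0" using inside by blast
    moreover from this have "\<phi> z + (\<phi> x0 - \<phi> z) / 2 < \<phi> x0" by (simp add: field_simps)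
    ultimately show ?thesis
      using x0(2) by (intro exI[of _ "(\<phi> x0 - \<phi> z) / 2"]) (auto intro: less_le_trans)
  qed
  then obtain \<epsilon> where \<epsilon>: "\<epsilon> > 0" "\<And>x. x \<in> K \<Longrightarrow> \<phi> z + \<epsilon> < \<phi> x" by blast
  define F where "F \<tau> = - \<epsilon> * exp (- 2 * \<alpha> * \<tau>)" for \<tau> :: real
  define F' where "F' \<tau> = 2 * \<alpha> * \<epsilon> * exp (- 2 * \<alpha> * \<tau>)" for \<tau> :: real
  have dF: "(F has_real_derivative F' \<tau>) (at \<tau>)" for \<tau>
    unfolding F_def F'_def by (auto intro!: derivative_eq_intros)
  have dF': "(F' has_real_derivative - 4 * \<alpha>\<^sup>2 * \<epsilon> * exp (- 2 * \<alpha> * \<tau>)) (at \<tau>)" for \<tau>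
    unfolding F'_def by (auto intro!: derivative_eq_intros simp: power2_eq_square)
  define G where "G x = \<phi> x + F ((norm (x - y))\<^sup>2 / 2)" for x
  have "continuous_on (cball z s) G"
    unfolding G_def F_def
    by (intro continuous_intros continuous_on_subset[OF continuous_\<phi>]) auto
  then obtain p where p: "p \<in> cball z s" "\<And>x. x \<in> cball z s \<Longrightarrow> G p \<le> G x"
    using continuous_attains_inf[of "cball z s" G] s by auto
  have p_int: "p \<in> ball z s"
  proof (rule ccontr)
    assume "p \<notin> ball z s"
    then have ps: "p \<in> sphere z s" using p(1) by auto
    have "G p \<le> G z" using p(2)[of z] s by simp
    moreover have "G z = \<phi> z - \<epsilon> * exp (- \<alpha> * \<rho>\<^sup>2)" by (simp add: G_def F_def zy)
    moreover have "G p = \<phi> p - \<epsilon> * exp (- \<alpha> * (norm (p - y))\<^sup>2)" by (simp add: G_def F_def)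
    moreover have "\<phi> z - \<epsilon> * exp (- \<alpha> * \<rho>\<^sup>2) < \<phi> p - \<epsilon> * exp (- \<alpha> * (norm (p - y))\<^sup>2)"
    proof (cases "p \<in> cball y \<rho>")
      case True
      then have "\<phi> z + \<epsilon> < \<phi> p" using \<epsilon>(2) ps by (auto simp: K_def)
      moreover have "\<epsilon> * exp (- \<alpha> * (norm (p - y))\<^sup>2) \<le> \<epsilon>" using \<epsilon>(1) \<alpha> by simp
      moreover have "0 < \<epsilon> * exp (- \<alpha> * \<rho>\<^sup>2)" using \<epsilon>(1) by simp
      ultimately show ?thesis by linarith
    next
      case False
      then have "\<rho> < norm (p - y)" by (simp add: dist_norm norm_minus_commute)
      then have "\<rho>\<^sup>2 < (norm (p - y))\<^sup>2" using \<rho> by (intro power_strict_mono) auto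
      then have "\<epsilon> * exp (- \<alpha> * (norm (p - y))\<^sup>2) < \<epsilon> * exp (- \<alpha> * \<rho>\<^sup>2)" using \<alpha> \<epsilon>(1) by simp
      moreover have "\<phi> z \<le> \<phi> p" using near[of p] p(1) s by auto
      ultimately show ?thesis by linarith
    qed
    ultimately show False by linarith
  qed
  define q where "q = p - y"
  have pz: "norm (p - z) < s" using p_int by (simp add: dist_norm norm_minus_commute)
  have zy': "z - y = q - (p - z)" by (simp add: q_def)
  have q_lb: "\<rho> / 2 \<le> norm q"
    using norm_triangle_ineq4[of q "p - z"] pz s zy unfolding zy' by linarith
  have q_ub: "norm q \<le> \<rho> + s"
    using norm_triangle_ineq[of "z - y" "p - z"] pz zy by (simp add: q_def)
  have p_ub: "norm p \<le> norm z + s"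
    using norm_triangle_ineq[of z "p - z"] pz by simp
  have q0: "q \<noteq> 0" using q_lb \<rho> by auto
  obtain e i0 where e: "orthonormal_frame (H p) e"
    and e0: "e i0 = (1 / sqrt (q \<bullet> (H p *v q))) *\<^sub>R q"
    using orthonormal_frame_exists[OF positive_definite_H q0] by metis
  obtain d where d: "d > 0" "ball p d \<subseteq> ball z s"
    using p_int open_ball open_contains_ball by metis
  define E where "E = exp (- 2 * \<alpha> * ((norm q)\<^sup>2 / 2))"
  have "1/2 * F' ((norm q)\<^sup>2 / 2) * (p \<bullet> q)
      \<le> (\<Sum>a\<in>UNIV. (- 4 * \<alpha>\<^sup>2 * \<epsilon> * E) * (e a \<bullet> q)\<^sup>2 + F' ((norm q)\<^sup>2 / 2) * (norm (e a))\<^sup>2)"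
    unfolding q_def E_def
  proof (rule radial_comparison[OF e _ d(1), where F = F])
    show "p \<noteq> y" using q0 by (simp add: q_def)
    show "\<phi> p + F ((norm (p - y))\<^sup>2 / 2) \<le> \<phi> x + F ((norm (x - y))\<^sup>2 / 2)"
      if "x \<in> ball p d" for x
      using p(2)[of x] d(2) that ball_subset_cball[of z s] unfolding G_def by blast
  qed (rule dF, rule dF')
  then have "(2 * \<alpha> * \<epsilon> * E) * (1/2 * (p \<bullet> q))
      \<le> (2 * \<alpha> * \<epsilon> * E) * (\<Sum>a\<in>UNIV. (norm (e a))\<^sup>2 - 2 * \<alpha> * (e a \<bullet> q)\<^sup>2)"
    unfolding sum_distrib_left by (simp add: F'_def E_def algebra_simps power2_eq_square)
  moreover have "2 * \<alpha> * \<epsilon> * E > 0" using \<alpha> \<epsilon> by (simp add: E_def)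
  ultimately have main: "1/2 * (p \<bullet> q) \<le> (\<Sum>a\<in>UNIV. (norm (e a))\<^sup>2 - 2 * \<alpha> * (e a \<bullet> q)\<^sup>2)"
    by (simp only: mult_le_cancel_left_pos)
  have "(norm (e a))\<^sup>2 \<le> 1 / l" for a
    using lb[OF p(1), of "e a"] e l by (simp add: orthonormal_frame_def field_simps)
  then have "(\<Sum>a\<in>UNIV. (norm (e a))\<^sup>2) \<le> real CARD('n) * (1 / l)"
    using sum_bounded_above[of UNIV "\<lambda>a. (norm (e a))\<^sup>2" "1 / l"] by simp
  moreover have "\<rho>\<^sup>2 / (4 * L) \<le> (\<Sum>a\<in>UNIV. (e a \<bullet> q)\<^sup>2)"
  proof -
    have Q: "0 < q \<bullet> (H p *v q)"
      using positive_definite_H q0 by (simp add: positive_definite_def)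
    \<comment> \<open>The frame vector parallel to \<open>q\<close> alone supplies the term that
      \<alpha> has to amplify.\<close>
    have "(e i0 \<bullet> q)\<^sup>2 = (norm q)^4 / (q \<bullet> (H p *v q))"
      using Q by (simp add: e0 power_divide power2_norm_eq_inner[symmetric] flip: power_mult)
    also have "\<dots> \<ge> (norm q)^4 / (L * (norm q)\<^sup>2)"
      using ub[OF p(1), of q] Q by (intro divide_left_mono) (auto intro: mult_pos_pos)
    finally have "(norm q)\<^sup>2 / L \<le> (e i0 \<bullet> q)\<^sup>2"
      using q0 L by (simp add: field_simps power2_eq_square power4_eq_xxxx)
    also have "\<dots> \<le> (\<Sum>a\<in>UNIV. (e a \<bullet> q)\<^sup>2)" by (rule member_le_sum) auto
    finally have 1: "(norm q)\<^sup>2 / L \<le> (\<Sum>a\<in>UNIV. (e a \<bullet> q)\<^sup>2)" .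
    have "(\<rho> / 2)\<^sup>2 \<le> (norm q)\<^sup>2" using q_lb \<rho> by (intro power_mono) auto
    then have "\<rho>\<^sup>2 / (4 * L) \<le> (norm q)\<^sup>2 / L" using L by (simp add: field_simps power_divide)
    then show ?thesis using 1 by linarith
  qed
  then have "2 * \<alpha> * (\<rho>\<^sup>2 / (4 * L)) \<le> 2 * \<alpha> * (\<Sum>a\<in>UNIV. (e a \<bullet> q)\<^sup>2)"
    using \<alpha> by (intro mult_left_mono) auto
  ultimately have "1/2 * (p \<bullet> q) \<le> real CARD('n) / l - \<alpha> * \<rho>\<^sup>2 / (2 * L)"
  proof -
    assume norms: "(\<Sum>a\<in>UNIV. (norm (e a))\<^sup>2) \<le> real CARD('n) * (1 / l)"
      and prods: "2 * \<alpha> * (\<rho>\<^sup>2 / (4 * L)) \<le> 2 * \<alpha> * (\<Sum>a\<in>UNIV. (e a \<bullet> q)\<^sup>2)"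
    have "1/2 * (p \<bullet> q)
        \<le> (\<Sum>a\<in>UNIV. (norm (e a))\<^sup>2) - 2 * \<alpha> * (\<Sum>a\<in>UNIV. (e a \<bullet> q)\<^sup>2)"
      using main by (simp only: sum_subtractf sum_distrib_left)
    also have "\<dots> \<le> real CARD('n) * (1 / l) - 2 * \<alpha> * (\<rho>\<^sup>2 / (4 * L))"
      by (intro diff_mono norms prods)
    finally show ?thesis by simp
  qed
  then have "1/2 * (p \<bullet> q) \<le> - C - 1" unfolding \<alpha>_eq by simp
  moreover have "- C \<le> p \<bullet> q"
  proof -
    have "norm p * norm q \<le> C"
      unfolding C_def by (intro mult_mono p_ub q_ub) (use s in auto)
    then show ?thesis using Cauchy_Schwarz_ineq2[of p q] by linarith
  qed
  ultimately show False using C by linarith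
qed

text \<open>The contact set is closed in \<open>S\<close>. Were it not open, a nearby noncontact
  point would have a nearest contact point, and a ball touching there would violate Hopf's argument;
  connectedness then finishes.\<close>

theorem strong_minimum_principle:
  assumes S: "open S" "connected S" and p: "p \<in> S" and min: "\<And>x. x \<in> S \<Longrightarrow> \<phi> p \<le> \<phi> x"
    and x: "x \<in> S"
  shows "\<phi> x = \<phi> p"
proof -
  define Z where "Z = {x \<in> S. \<phi> x = \<phi> p}"
  have "closedin (top_of_set S) Z"
    unfolding Z_def by (intro continuous_closedin_preimage_constant continuous_on_subset[OF continuous_\<phi>]) auto
  moreover have "openin (top_of_set S) Z"
  proof -
    have "open Z"
      unfolding open_contains_ball
    proof
      fix z0 assume z0: "z0 \<in> Z"
      then obtain R where R: "R > 0" "cball z0 R \<subseteq> S"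
        using S(1) by (auto simp: Z_def open_contains_cball)
      \<comment> \<open>For \<open>x1\<close> within R/2 of \<open>z0\<close>, the nearest contact
        point is less than R/2 from \<open>x1\<close>, so it and the touching ball stay inside
        \<open>cball z0 R\<close>.\<close>
      have "ball z0 (R / 2) \<subseteq> Z"
      proof
        fix x1 assume x1: "x1 \<in> ball z0 (R / 2)"
        show "x1 \<in> Z"
        proof (rule ccontr)
          assume "x1 \<notin> Z"
          define Y where "Y = cball z0 R \<inter> {x. \<phi> x = \<phi> p}"
          have "closed {x. \<phi> x = \<phi> p}"
            using continuous_closed_preimage_constant[OF continuous_\<phi> closed_UNIV] by simp
          then have Y: "closed Y" unfolding Y_def by auto
          have z0Y: "z0 \<in> Y" using z0 R by (auto simp: Y_def Z_def)
          obtain z where z: "z \<in> Y" "\<And>y. y \<in> Y \<Longrightarrow> dist x1 z \<le> dist x1 y"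
            using distance_attains_inf[OF Y] z0Y by blast
          define \<rho> where "\<rho> = dist x1 z / 2"
          \<comment> \<open>Halving the ball about \<open>x1\<close> towards \<open>z\<close> makes
            the contact isolated: by the parallelogram identity the smaller closed ball meets the
            larger sphere only at \<open>z\<close>.\<close>
          define y where "y = (1/2) *\<^sub>R (x1 + z)"
          have "x1 \<in> cball z0 R" using x1 R by auto
          then have "x1 \<noteq> z" using z(1) \<open>x1 \<notin> Z\<close> R by (auto simp: Y_def Z_def)
          then have \<rho>: "\<rho> > 0" by (simp add: \<rho>_def)
          have "z - y = (1/2) *\<^sub>R (z - x1)" "y - x1 = (1/2) *\<^sub>R (z - x1)"
            by (simp_all add: vec_eq_iff y_def field_simps)
          then have zy: "norm (z - y) = \<rho>" and mid: "y - x1 = z - y"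
            by (simp_all add: \<rho>_def dist_norm norm_minus_commute)
          have x1z: "dist x1 z < R / 2"
            using z(2)[OF z0Y] x1 by (simp add: dist_commute)
          have "dist z0 z < R"
            using dist_triangle[of z0 z x1] x1z x1 by simp
          then obtain r where r: "r > 0" "cball z r \<subseteq> ball z0 R"
            using open_contains_cball[of "ball z0 R"] by (metis mem_ball open_ball)
          have \<phi>z: "\<phi> z = \<phi> p" using z(1) by (simp add: Y_def)
          show False
          proof (rule no_isolated_contact[OF \<rho> zy r(1)])
            show "\<phi> z \<le> \<phi> x" if "x \<in> cball z r" for x
            proof -
              have "x \<in> S" using that r(2) R(2) ball_subset_cball[of z0 R] by blast
              then show ?thesis using min \<phi>z by simp
            qed
          next
            fix x assume x: "x \<in> cball y \<rho>" "x \<noteq> z"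
            have xy: "norm (x - y) \<le> \<rho>" using x(1) by (simp add: dist_norm norm_minus_commute)
            have "x - x1 = (x - y) + (z - y)" using mid by (simp add: algebra_simps)
            moreover have "x - z = (x - y) - (z - y)" by simp
            ultimately have par: "(norm (x - x1))\<^sup>2 + (norm (x - z))\<^sup>2 = 2 * (norm (x - y))\<^sup>2 + 2 * \<rho>\<^sup>2"
              unfolding zy[symmetric] using parallelogram_identity[of "x - y" "z - y"] by (simp only:)
            have "(norm (x - y))\<^sup>2 \<le> \<rho>\<^sup>2" using xy by (intro power_mono) auto
            moreover have "(norm (x - z))\<^sup>2 > 0" using x(2) by simp
            moreover have "(2 * \<rho>)\<^sup>2 = 4 * \<rho>\<^sup>2" by (simp add: power_mult_distrib)
            ultimately have "(norm (x - x1))\<^sup>2 < (2 * \<rho>)\<^sup>2"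
              using par by linarith
            then have "norm (x - x1) < 2 * \<rho>" by (rule power_less_imp_less_base) (use \<rho> in simp)
            then have close: "dist x1 x < dist x1 z" by (simp add: \<rho>_def dist_norm norm_minus_commute)
            then have "x \<notin> Y" using z(2)[of x] by auto
            moreover have "x \<in> cball z0 R"
              using dist_triangle[of z0 x x1] close x1z x1 by simp
            ultimately show "\<phi> z < \<phi> x" using min[of x] R(2) \<phi>z by (force simp: Y_def)
          qed
        qed
      qed
      then show "\<exists>e>0. ball z0 e \<subseteq> Z" using R(1) by (intro exI[of _ "R / 2"]) auto
    qed
    then show ?thesis by (simp add: Z_def openin_open_eq S(1))
  qed
  moreover have "p \<in> Z" using p by (simp add: Z_def)
  ultimately have "Z = S" using S(2) unfolding connected_clopen by blast
  then show ?thesis using x by (auto simp: Z_def)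
qed

end

section \<open>The self-shrinker potential\<close>

text \<open>Subtracting the tangent line from \<open>u\<close> along \<open>v\<close> gives a
  function with a minimum at 0, to which the second derivative test applies.\<close>

lemma convex_on_imp_hessian_nonneg:
  fixes u :: "real^'n::finite \<Rightarrow> real"
  assumes u: "smooth u" and conv: "convex_on UNIV u"
  shows "0 \<le> v \<bullet> (hessian u x *v v)"
proof -
  define g where "g t = u (x + t *\<^sub>R v) - t * (v \<bullet> gradient u x)" for t
  define g' where "g' t = v \<bullet> gradient u (x + t *\<^sub>R v) - v \<bullet> gradient u x" for t
  have du: "((\<lambda>t. u (x + t *\<^sub>R v)) has_real_derivative v \<bullet> gradient u (x + t *\<^sub>R v)) (at t)" for t
    by (rule smooth_line_derivative[OF u])
  have "convex_on UNIV (\<lambda>t. u (x + t *\<^sub>R v))"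
  proof (rule convex_onI)
    fix t a b :: real
    assume t: "0 < t" "t < 1"
    have "x + ((1 - t) *\<^sub>R a + t *\<^sub>R b) *\<^sub>R v = (1 - t) *\<^sub>R (x + a *\<^sub>R v) + t *\<^sub>R (x + b *\<^sub>R v)"
      by (simp add: algebra_simps)
    then show "u (x + ((1 - t) *\<^sub>R a + t *\<^sub>R b) *\<^sub>R v)
        \<le> (1 - t) * u (x + a *\<^sub>R v) + t * u (x + b *\<^sub>R v)"
      using convex_onD[OF conv, of t "x + a *\<^sub>R v" "x + b *\<^sub>R v"] t by simp
  qed simp
  then have "u (x + t *\<^sub>R v) - u (x + 0 *\<^sub>R v) \<ge> (v \<bullet> gradient u (x + 0 *\<^sub>R v)) * (t - 0)" for t
    by (rule convex_on_imp_above_tangent) (auto intro: du[of 0, simplified])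
  then have min: "g 0 \<le> g t" for t by (simp add: g_def algebra_simps)
  have dg: "(g has_real_derivative g' t) (at t)" for t
    unfolding g_def g'_def by (auto intro!: derivative_eq_intros du)
  have dg': "(g' has_real_derivative v \<bullet> (hessian u (x + 0 *\<^sub>R v) *v v)) (at 0)"
    unfolding g'_def
    using DERIV_diff[OF gradient_line_derivative[OF u, of v x v 0] DERIV_const] by simp
  show ?thesis
    using second_derivative_test_nonneg(2)[of 1 g g'] min dg dg' by simp
qed

lemma positive_semidefinite_imp_positive_definite:
  fixes A :: "real^'n::finite^'n"
  assumes sym: "transpose A = A" and nonneg: "\<And>v. 0 \<le> v \<bullet> (A *v v)" and det: "det A \<noteq> 0"
  shows "positive_definite A"
  unfolding positive_definite_def
proof (intro conjI sym allI impI)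
  fix v :: "real^'n" assume v: "v \<noteq> 0"
  have "A *v v \<noteq> 0"
    using v det by (metis invertible_det_nz matrix_left_invertible_ker invertible_left_inverse)
  define w where "w = A *v v"
  have w: "w \<bullet> w > 0" using \<open>A *v v \<noteq> 0\<close> by (simp add: w_def)
  show "0 < v \<bullet> (A *v v)"
  proof (rule ccontr)
    assume "\<not> 0 < v \<bullet> (A *v v)"
    then have z: "v \<bullet> (A *v v) = 0" using nonneg[of v] by simp
    define g where "g t = (v + t *\<^sub>R w) \<bullet> (A *v (v + t *\<^sub>R w))" for t
    have g: "g t = 2 * t * (w \<bullet> w) + t\<^sup>2 * (w \<bullet> (A *v w))" for t
      using z symmetric_matrix_inner[OF sym, of v w]
      by (simp add: g_def matrix_vector_right_distrib matrix_vector_mult_scaleR inner_add_left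
          inner_add_right w_def[symmetric] power2_eq_square algebra_simps)
    \<comment> \<open>Moving \<open>v\<close> slightly against \<open>w\<close> makes the form
      negative, because the linear term 2t|w|^2 dominates; the added 1 keeps the divisor positive
      when the quadratic coefficient vanishes.\<close>
    define k where "k = w \<bullet> (A *v w) + 1"
    have k: "k > 0" using nonneg[of w] by (simp add: k_def)
    have b: "w \<bullet> (A *v w) = k - 1" by (simp add: k_def)
    have "g (- (w \<bullet> w) / k) = ((w \<bullet> w)\<^sup>2 / k) * ((k - 1) / k - 2)"
      unfolding g b using k by (simp add: field_simps power2_eq_square)
    also have "\<dots> < 0"
      using k w by (intro mult_pos_neg) (auto simp: field_simps)
    finally show False using nonneg[of "v + (- (w \<bullet> w) / k) *\<^sub>R w"] by (simp add: g_def)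
  qed
qed

text \<open>The frame vectors have length at most c^(-1/2), so the Leibniz formula bounds |det E| by
  n! c^(-n/2), and det A = (det E)^(-2). The loss of (n!)^2 is harmless: after taking logarithms it
  is an additive constant.\<close>

lemma det_lower_bound:
  fixes A :: "real^'n::finite^'n"
  assumes A: "positive_definite A" and c: "c > 0" and ge: "\<And>v. c * (norm v)\<^sup>2 \<le> v \<bullet> (A *v v)"
  shows "c ^ CARD('n) / (fact CARD('n))\<^sup>2 \<le> det A"
proof -
  obtain e where e: "orthonormal_frame A e"
    using orthonormal_frame_exists[OF A, of "axis undefined 1" undefined] by (metis axis_eq_0_iff zero_neq_one)
  define E :: "real^'n^'n" where "E = (\<chi> i a. e a $ i)"
  have E: "(det E)\<^sup>2 * det A = 1"
    using orthonormal_frame_congruence(3)[OF e] by (simp add: E_def)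
  have "(norm (e a))\<^sup>2 \<le> 1 / c" for a
    using ge[of "e a"] e c by (simp add: orthonormal_frame_def field_simps)
  then have "norm (e a) \<le> sqrt (1 / c)" for a by (simp add: real_le_rsqrt)
  then have entry: "\<bar>E $ i $ a\<bar> \<le> sqrt (1 / c)" for i a
    using component_le_norm_cart[of "e a" i] order_trans by (fastforce simp: E_def)
  have "\<bar>det E\<bar> \<le> (\<Sum>p\<in>{p. p permutes (UNIV :: 'n set)}. \<bar>of_int (sign p) * (\<Prod>i\<in>UNIV. E $ i $ p i)\<bar>)"
    unfolding det_def by (rule sum_abs)
  also have "\<dots> \<le> (\<Sum>p\<in>{p. p permutes (UNIV :: 'n set)}. sqrt (1 / c) ^ CARD('n))"
  proof (rule sum_mono)
    fix p :: "'n \<Rightarrow> 'n"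
    have "(\<Prod>i\<in>UNIV. \<bar>E $ i $ p i\<bar>) \<le> (\<Prod>i\<in>(UNIV :: 'n set). sqrt (1 / c))"
      by (intro prod_mono) (use entry in auto)
    then show "\<bar>of_int (sign p) * (\<Prod>i\<in>UNIV. E $ i $ p i)\<bar> \<le> sqrt (1 / c) ^ CARD('n)"
      by (simp add: abs_mult abs_prod sign_def)
  qed
  also have "\<dots> = fact CARD('n) * sqrt (1 / c) ^ CARD('n)"
    by (simp add: card_permutations)
  finally have "\<bar>det E\<bar>\<^sup>2 \<le> (fact CARD('n) * sqrt (1 / c) ^ CARD('n))\<^sup>2"
    by (intro power_mono) auto
  also have "\<dots> = (fact CARD('n))\<^sup>2 * (sqrt (1 / c) ^ 2) ^ CARD('n)"
    by (simp only: power_mult_distrib power_mult[symmetric] mult.commute[of 2])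
  also have "\<dots> = (fact CARD('n))\<^sup>2 / c ^ CARD('n)"
    using c by (simp add: power_one_over divide_inverse power_inverse)
  finally have le: "(det E)\<^sup>2 \<le> (fact CARD('n))\<^sup>2 / c ^ CARD('n)" by simp
  have E0: "(det E)\<^sup>2 > 0" using E by (cases "det E = 0") auto
  have "det A = 1 / (det E)\<^sup>2" using E E0 by (simp add: field_simps)
  also have "\<dots> \<ge> 1 / ((fact CARD('n))\<^sup>2 / c ^ CARD('n))"
    using le E0 c by (intro divide_left_mono mult_pos_pos) auto
  finally show ?thesis by simp
qed

text \<open>The equation says that v(x,t) = -t u(x / sqrt(-t)), for t < 0, solves v_t = ln det D^2v:
  a solution that shrinks self-similarly.\<close>

locale self_shrinker =
  fixes u :: "real^'n::finite \<Rightarrow> real"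
  assumes smooth_u: "smooth u"
    and convex_u: "convex_on UNIV u"
    and det_pos: "det (hessian u x) > 0"
    and equation: "ln (det (hessian u x)) = 1/2 * (x \<bullet> gradient u x) - u x"
begin

definition \<phi> :: "real^'n \<Rightarrow> real" where
  "\<phi> x = 1/2 * (x \<bullet> gradient u x) - u x"

definition D\<phi> :: "real^'n \<Rightarrow> real^'n \<Rightarrow> real" where
  "D\<phi> x v = 1/2 * (x \<bullet> (hessian u x *v v) - v \<bullet> gradient u x)"

definition hessian_derivative :: "real^'n \<Rightarrow> real^'n \<Rightarrow> real^'n^'n" where
  "hessian_derivative x w = (\<chi> k l. w \<bullet> gradient (partial_deriv l (partial_deriv k u)) x)"

lemma hessian_line_derivative:
  "((\<lambda>t. hessian u (x + t *\<^sub>R w) $ k $ l) has_real_derivative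
    hessian_derivative (x + t *\<^sub>R w) w $ k $ l) (at t)"
  by (simp add: hessian_def hessian_derivative_def smooth_line_derivative smooth_partial_deriv smooth_u)

lemma positive_definite_hessian: "positive_definite (hessian u x)"
  using det_pos[of x]
  by (intro positive_semidefinite_imp_positive_definite transpose_hessian smooth_u
      convex_on_imp_hessian_nonneg convex_u) auto

text \<open>Both sides are D^3u(x, v, v) at the point x; the full symmetry of third derivatives lets
  the position vector move into the slot of differentiation, where it meets Jacobi's
  formula.\<close>

lemma hessian_derivative_commute:
  "x \<bullet> (hessian_derivative x v *v v) = v \<bullet> (hessian_derivative x x *v v)"
proof -
  let ?T = "\<lambda>k l i. partial_deriv i (partial_deriv l (partial_deriv k u)) x"
  have T: "?T k l i = ?T i l k" for k l i
    by (metis (no_types, opaque_lifting) partial_deriv_commute smooth_partial_deriv smooth_u ext)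
  have exp: "a \<bullet> (hessian_derivative x w *v b)
      = (\<Sum>k\<in>UNIV. \<Sum>l\<in>UNIV. \<Sum>i\<in>UNIV. a $ k * (b $ l * (w $ i * ?T k l i)))" for a b w
    by (simp add: inner_vec_def matrix_vector_mult_def hessian_derivative_def gradient_def
        sum_distrib_left sum_distrib_right mult_ac)
  have "x \<bullet> (hessian_derivative x v *v v)
      = (\<Sum>k\<in>UNIV. \<Sum>l\<in>UNIV. \<Sum>i\<in>UNIV. v $ i * (v $ l * (x $ k * ?T i l k)))"
    unfolding exp by (intro sum.cong refl) (subst T, simp)
  also have "\<dots> = (\<Sum>k\<in>UNIV. \<Sum>i\<in>UNIV. \<Sum>l\<in>UNIV. v $ i * (v $ l * (x $ k * ?T i l k)))"
    by (intro sum.cong refl sum.swap)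
  also have "\<dots> = (\<Sum>i\<in>UNIV. \<Sum>k\<in>UNIV. \<Sum>l\<in>UNIV. v $ i * (v $ l * (x $ k * ?T i l k)))"
    by (rule sum.swap)
  also have "\<dots> = (\<Sum>i\<in>UNIV. \<Sum>l\<in>UNIV. \<Sum>k\<in>UNIV. v $ i * (v $ l * (x $ k * ?T i l k)))"
    by (intro sum.cong refl sum.swap)
  also have "\<dots> = v \<bullet> (hessian_derivative x x *v v)" unfolding exp ..
  finally show ?thesis .
qed

lemma \<phi>_line_derivative:
  "((\<lambda>t. \<phi> (x + t *\<^sub>R v)) has_real_derivative D\<phi> (x + t *\<^sub>R v) v) (at t)"
proof -
  have split: "\<phi> (x + t *\<^sub>R v)
      = 1/2 * (x \<bullet> gradient u (x + t *\<^sub>R v) + t * (v \<bullet> gradient u (x + t *\<^sub>R v))) - u (x + t *\<^sub>R v)" for t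
    by (simp add: \<phi>_def inner_add_left)
  show ?thesis
    unfolding split D\<phi>_def
    by (rule derivative_eq_intros gradient_line_derivative smooth_line_derivative smooth_u refl)+
      (simp add: inner_add_left algebra_simps)
qed

text \<open>The moving base point in x . Hv and the term v . Du each contribute v . Hv, with
  opposite signs, so only the third derivative survives.\<close>

lemma D\<phi>_line_derivative:
  "((\<lambda>t. D\<phi> (x + t *\<^sub>R v) v) has_real_derivative 1/2 * (v \<bullet> (hessian_derivative x x *v v))) (at 0)"
proof -
  have H: "((\<lambda>t. w \<bullet> (hessian u (x + t *\<^sub>R v) *v v)) has_real_derivative
      w \<bullet> (hessian_derivative (x + t *\<^sub>R v) v *v v)) (at t)" for w t
  proof -
    have "((\<lambda>t. \<Sum>k\<in>UNIV. w $ k * (\<Sum>l\<in>UNIV. hessian u (x + t *\<^sub>R v) $ k $ l * v $ l)) has_real_derivative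
      (\<Sum>k\<in>UNIV. w $ k * (\<Sum>l\<in>UNIV. hessian_derivative (x + t *\<^sub>R v) v $ k $ l * v $ l))) (at t)"
      by (intro DERIV_sum DERIV_cmult DERIV_cmult_right hessian_line_derivative)
    then show ?thesis by (simp add: inner_vec_def matrix_vector_mult_def)
  qed
  have split: "D\<phi> (x + t *\<^sub>R v) v = 1/2 * (x \<bullet> (hessian u (x + t *\<^sub>R v) *v v)
      + t * (v \<bullet> (hessian u (x + t *\<^sub>R v) *v v)) - v \<bullet> gradient u (x + t *\<^sub>R v))" for t
    by (simp add: D\<phi>_def inner_add_left)
  show ?thesis
    unfolding split
    by (rule derivative_eq_intros H gradient_line_derivative smooth_u refl)+
      (simp add: hessian_derivative_commute)
qed

text \<open>Differentiating \<open>\<phi> = ln det D\<^sup>2u\<close> in the direction \<open>x\<close> by Jacobi's formula gives the trace of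
  the third derivatives that also appears in the second derivatives of \<open>1/2 x \<bullet> Du - u\<close>.\<close>

sublocale drift_harmonic "hessian u" \<phi> D\<phi> "\<lambda>x v. 1/2 * (v \<bullet> (hessian_derivative x x *v v))"
proof
  show "continuous_on UNIV (hessian u)" by (rule continuous_on_hessian[OF smooth_u])
  show "continuous_on UNIV \<phi>"
    unfolding \<phi>_def
    by (intro continuous_intros smooth_continuous_on continuous_on_gradient smooth_u)
  show "positive_definite (hessian u x)" for x by (rule positive_definite_hessian)
  show "((\<lambda>t. \<phi> (x + t *\<^sub>R v)) has_real_derivative D\<phi> (x + t *\<^sub>R v) v) (at t)" for x v t
    by (rule \<phi>_line_derivative)
  show "((\<lambda>t. D\<phi> (x + t *\<^sub>R v) v) has_real_derivative 1/2 * (v \<bullet> (hessian_derivative x x *v v))) (at 0)" for x v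
    by (rule D\<phi>_line_derivative)
next
  fix x e assume e: "orthonormal_frame (hessian u x) e"
  have "((\<lambda>t. ln (det (hessian u (x + t *\<^sub>R x)))) has_real_derivative
      (\<Sum>a\<in>UNIV. e a \<bullet> (hessian_derivative x x *v e a))) (at 0)"
    using hessian_line_derivative[of x x _ _ 0] e by (intro ln_det_derivative) simp_all
  then have "((\<lambda>t. \<phi> (x + t *\<^sub>R x)) has_real_derivative
      (\<Sum>a\<in>UNIV. e a \<bullet> (hessian_derivative x x *v e a))) (at 0)"
    by (simp add: equation \<phi>_def)
  from DERIV_unique[OF this \<phi>_line_derivative[of x x 0]]
  have "(\<Sum>a\<in>UNIV. e a \<bullet> (hessian_derivative x x *v e a)) = D\<phi> x x" by simp
  then show "(\<Sum>a\<in>UNIV. 1/2 * (e a \<bullet> (hessian_derivative x x *v e a))) = 1/2 * D\<phi> x x"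
    by (simp only: sum_distrib_left[symmetric])
qed

section \<open>From constant \<phi> to a quadratic polynomial\<close>

text \<open>Constancy gives u(x) = u(0) + 1/2 x . Du(x), so it suffices to identify x . Du(x) on
  each ray. There g(t) = x . Du(tx) satisfies t g' = g, hence g(t)/t is constant for t > 0 and
  equals its limit g'(0).\<close>

lemma quadratic_if_\<phi>_constant:
  assumes const: "\<And>x. \<phi> x = \<phi> 0"
  shows "u x = u 0 + 1/2 * ((hessian u 0 *v x) \<bullet> x)"
proof -
  have D0: "D\<phi> x v = 0" for x v
  proof -
    have "((\<lambda>t. \<phi> 0) has_real_derivative D\<phi> x v) (at 0)"
      using \<phi>_line_derivative[of x v 0] by (simp add: const[of "_ + _"])
    then show ?thesis using DERIV_unique DERIV_const by blast
  qed
  have euler: "x \<bullet> (hessian u x *v v) = v \<bullet> gradient u x" for x v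
    using D0[of x v] by (simp add: D\<phi>_def)
  define g where "g t = x \<bullet> gradient u (t *\<^sub>R x)" for t
  define g' where "g' t = x \<bullet> (hessian u (t *\<^sub>R x) *v x)" for t
  have dg: "(g has_real_derivative g' t) (at t)" for t
    using gradient_line_derivative[OF smooth_u, of x 0 x t] by (simp add: g_def[abs_def] g'_def)
  have tg': "t * g' t = g t" for t
    using euler[of "t *\<^sub>R x" x] by (simp add: g_def g'_def)
  have g0: "g 0 = 0" using tg'[of 0] by simp
  have linear: "g t / t = g 1" if t: "0 < t" "t < 1" for t
  proof -
    have "((\<lambda>s. g s / s) has_real_derivative 0) (at s)" if "t \<le> s" for s
    proof -
      have s: "s > 0" using that t by simp
      have "((\<lambda>s. g s / s) has_real_derivative (g' s * s - g s * 1) / (s * s)) (at s)"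
        by (rule DERIV_divide[OF dg DERIV_ident]) (use s in simp)
      then show ?thesis using tg'[of s] by (simp add: mult.commute)
    qed
    moreover from this have "continuous_on {t..1} (\<lambda>s. g s / s)"
      by (intro continuous_at_imp_continuous_on ballI DERIV_isCont[where D = 0]) auto
    ultimately have "g 1 / 1 = g t / t"
      using t by (intro DERIV_isconst_end[of t 1 "\<lambda>s. g s / s"]) auto
    then show ?thesis by simp
  qed
  have "((\<lambda>t. g t / t) \<longlongrightarrow> g' 0) (at_right 0)"
    using dg[of 0] g0 unfolding DERIV_def by (auto intro: filterlim_mono at_le)
  moreover have "\<forall>\<^sub>F t in at_right 0. g t / t = g 1"
    unfolding eventually_at_right_field using linear by (intro exI[of _ 1]) auto
  ultimately have "((\<lambda>t. g 1) \<longlongrightarrow> g' 0) (at_right (0::real))"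
    by (rule Lim_transform_eventually)
  then have "g' 0 = g 1" by (simp add: tendsto_const_iff)
  moreover have "u x = 1/2 * (x \<bullet> gradient u x) + u 0"
    using const[of x] by (simp add: \<phi>_def)
  ultimately show ?thesis by (simp add: g_def g'_def inner_commute)
qed

section \<open>The two cases of the hypothesis\<close>

text \<open>The term x . Du(x) is the derivative of u((1 + t) x) at t = 0, and that function of t
  depends on |x| only.\<close>

lemma \<phi>_radially_symmetric:
  assumes "radially_symmetric u"
  shows "radially_symmetric \<phi>"
  unfolding radially_symmetric_def
proof (intro allI impI)
  fix x y :: "real^'n" assume xy: "norm x = norm y"
  have "u (x + t *\<^sub>R x) = u (y + t *\<^sub>R y)" for t
  proof -
    have "norm ((1 + t) *\<^sub>R x) = norm ((1 + t) *\<^sub>R y)" using xy by simp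
    then show ?thesis
      using assms unfolding radially_symmetric_def by (metis scaleR_left_distrib scaleR_one)
  qed
  then have "x \<bullet> gradient u x = y \<bullet> gradient u y"
    using smooth_line_derivative[OF smooth_u, of x x 0] smooth_line_derivative[OF smooth_u, of y y 0]
    by (auto intro: DERIV_unique)
  moreover have "u x = u y" using assms xy unfolding radially_symmetric_def by blast
  ultimately show "\<phi> x = \<phi> y" by (simp add: \<phi>_def)
qed

lemma \<phi>_constant_if_radially_symmetric:
  assumes "radially_symmetric u"
  shows "\<phi> x = \<phi> 0"
proof -
  interpret neg: drift_harmonic "hessian u" "\<lambda>x. - \<phi> x" "\<lambda>x v. - D\<phi> x v"
    "\<lambda>x v. - (1/2 * (v \<bullet> (hessian_derivative x x *v v)))"
    by (rule drift_harmonic_uminus)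
  define R where "R = norm x + 1"
  have R: "R > 0" using norm_ge_zero[of x] by (simp add: R_def add_nonneg_pos)
  have x: "x \<in> ball 0 R" by (simp add: R_def)
  have B: "compact (cball (0 :: real^'n) R)" "cball (0 :: real^'n) R \<noteq> {}" using R by auto
  have cont: "continuous_on (cball 0 R) \<phi>" by (rule continuous_on_subset[OF continuous_\<phi>]) simp
  obtain p where p: "p \<in> cball 0 R" "\<And>y. y \<in> cball 0 R \<Longrightarrow> \<phi> p \<le> \<phi> y"
    using continuous_attains_inf[OF B cont] by blast
  obtain q where q: "q \<in> cball 0 R" "\<And>y. y \<in> cball 0 R \<Longrightarrow> \<phi> y \<le> \<phi> q"
    using continuous_attains_sup[OF B cont] by blast
  have x0: "x \<in> cball 0 R" "0 \<in> cball 0 R" using x R by auto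
  consider "p \<in> ball 0 R" | "q \<in> ball 0 R" | "norm p = R" "norm q = R"
    using p(1) q(1) by force
  then show ?thesis
  proof cases
    case 1
    have "\<phi> y = \<phi> p" if "y \<in> ball 0 R" for y
      by (rule strong_minimum_principle[OF open_ball connected_ball 1 _ that]) (use p(2) in simp)
    then show ?thesis using x R by simp
  next
    case 2
    have "- \<phi> y = - \<phi> q" if "y \<in> ball 0 R" for y
      by (rule neg.strong_minimum_principle[OF open_ball connected_ball 2 _ that]) (use q(2) in simp)
    then show ?thesis using x R by simp
  next
    \<comment> \<open>Both extremes lie on one sphere, where \<phi> takes a single value, so the
      minimum and maximum over the closed ball coincide.\<close>
    case 3
    then have "\<phi> p = \<phi> q"
      using \<phi>_radially_symmetric[OF assms] by (simp add: radially_symmetric_def)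
    then show ?thesis using p(2) q(2) x0 by (metis order_antisym order_trans)
  qed
qed

text \<open>The barrier is \<open>\<epsilon> |x|\<close>: its Hessian annihilates \<open>x\<close> and equals \<open>\<epsilon> / |x|\<close> on the orthogonal
  complement.  A frame that starts with a multiple of \<open>p\<close> therefore loses exactly one of the \<open>n\<close>
  terms, which is why the constant \<open>2 (n - 1)\<close> is the threshold.\<close>

lemma \<phi>_constant_if_hessian_lower_bound:
  assumes \<delta>: "\<delta> > 0" and R: "R > 0"
    and lower: "\<And>x v. norm x \<ge> R \<Longrightarrow>
      2 * (real CARD('n) - 1 + \<delta>) / (norm x)\<^sup>2 * (norm v)\<^sup>2 \<le> v \<bullet> (hessian u x *v v)"
  shows "\<phi> x = \<phi> 0"
proof -
  define k where "k = 2 * (real CARD('n) - 1 + \<delta>)"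
  have n1: "real CARD('n) \<ge> 1" by (simp add: Suc_leI)
  have k: "k > 0"
    unfolding k_def by (intro mult_pos_pos add_nonneg_pos) (use n1 \<delta> in auto)
  have log_bound: "real CARD('n) * ln k - 2 * ln (fact CARD('n)) - 2 * real CARD('n) * ln (norm x) \<le> \<phi> x"
    if x: "norm x \<ge> R" for x
  proof -
    have x0: "norm x > 0" using x R by linarith
    have "(k / (norm x)\<^sup>2) ^ CARD('n) / (fact CARD('n))\<^sup>2 \<le> det (hessian u x)"
      using lower[OF x] x0 k by (intro det_lower_bound positive_definite_hessian) (auto simp: k_def)
    then have "ln ((k / (norm x)\<^sup>2) ^ CARD('n) / (fact CARD('n))\<^sup>2) \<le> ln (det (hessian u x))"
      using k x0 det_pos[of x] by (subst ln_le_cancel_iff) auto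
    also have "\<dots> = \<phi> x" by (simp add: equation \<phi>_def)
    also have "ln ((k / (norm x)\<^sup>2) ^ CARD('n) / (fact CARD('n))\<^sup>2)
        = real CARD('n) * ln k - 2 * ln (fact CARD('n)) - 2 * real CARD('n) * ln (norm x)"
      using k x0 by (simp add: ln_div ln_realpow algebra_simps)
    finally show ?thesis .
  qed
  have cont: "continuous_on (cball 0 R) \<phi>" by (rule continuous_on_subset[OF continuous_\<phi>]) simp
  have B: "compact (cball (0 :: real^'n) R)" "cball (0 :: real^'n) R \<noteq> {}" using R by auto
  obtain p0 where p0: "\<And>y. y \<in> cball 0 R \<Longrightarrow> \<phi> p0 \<le> \<phi> y"
    using continuous_attains_inf[OF B cont] by blast
  \<comment> \<open>On the exterior \<open>\<phi> + \<epsilon> |x|\<close> attains its minimum, and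
    the barrier forces it onto the sphere of radius \<open>R\<close>, where \<open>\<phi>\<close> is
    at least \<open>\<phi> p0\<close>.\<close>
  have outside: "\<phi> p0 - \<epsilon> * norm x \<le> \<phi> x" if \<epsilon>: "\<epsilon> > 0" and x: "norm x \<ge> R" for \<epsilon> x
  proof -
    define G where "G y = \<phi> y + \<epsilon> * norm y" for y
    have "filterlim (\<lambda>r. \<epsilon> * r + (real CARD('n) * ln k - 2 * ln (fact CARD('n)) - 2 * real CARD('n) * ln r))
        at_top at_top"
      using \<epsilon> by real_asymp
    then have "\<forall>\<^sub>F r in at_top. G x <
        \<epsilon> * r + (real CARD('n) * ln k - 2 * ln (fact CARD('n)) - 2 * real CARD('n) * ln r)"
      by (simp add: filterlim_at_top_dense)
    then obtain N where N: "\<And>r. r \<ge> N \<Longrightarrow> G x <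
        \<epsilon> * r + (real CARD('n) * ln k - 2 * ln (fact CARD('n)) - 2 * real CARD('n) * ln r)"
      unfolding eventually_at_top_linorder by blast
    \<comment> \<open>Beyond radius \<open>N\<close> the function exceeds its value at
      \<open>x\<close>. A shell containing \<open>x\<close> and reaching that far thus has the
      minimum of the whole exterior.\<close>
    define M where "M = max N (norm x)"
    define K where "K = cball 0 M - ball (0 :: real^'n) R"
    have K: "compact K" "x \<in> K" using x by (auto simp: K_def M_def intro: compact_diff)
    have "continuous_on K G"
      unfolding G_def by (intro continuous_intros continuous_on_subset[OF continuous_\<phi>]) auto
    then obtain p where p: "p \<in> K" "\<And>y. y \<in> K \<Longrightarrow> G p \<le> G y"
      using continuous_attains_inf[of K G] K by blast
    have pmin: "G p \<le> G y" if y: "norm y \<ge> R" for y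
    proof (cases "norm y \<le> M")
      case True
      then show ?thesis using p(2)[of y] y by (auto simp: K_def)
    next
      case False
      then have "norm y \<ge> N" by (simp add: M_def)
      from N[OF this] log_bound[OF y] have "G x < G y" by (simp add: G_def)
      then show ?thesis using p(2)[OF K(2)] by linarith
    qed
    have pR: "norm p \<ge> R" using p(1) by (simp add: K_def)
    have "norm p = R"
    proof (rule ccontr)
      assume "norm p \<noteq> R"
      then have pR': "norm p > R" using pR by simp
      then have p0: "p \<noteq> 0" and np: "norm p > 0" using R by auto
      obtain e i0 where e: "orthonormal_frame (hessian u p) e"
        and e0: "e i0 = (1 / sqrt (p \<bullet> (hessian u p *v p))) *\<^sub>R p"
        using orthonormal_frame_exists[OF positive_definite_hessian p0] by metis
      define c where "c = 1 / sqrt (p \<bullet> (hessian u p *v p))"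
      have sqrt_norm: "sqrt (2 * ((norm y)\<^sup>2 / 2)) = norm y" for y :: "real^'n" by simp
      define F where "F s = \<epsilon> * sqrt (2 * s)" for s
      define F' where "F' s = \<epsilon> / sqrt (2 * s)" for s
      have dF: "(F has_real_derivative F' s) (at s)" if "s > 0" for s
        unfolding F_def F'_def using that by (auto intro!: derivative_eq_intros simp: field_simps)
      have dF': "(F' has_real_derivative - \<epsilon> / sqrt (2 * s) ^ 3) (at s)" if "s > 0" for s
        unfolding F'_def using that
        by (auto intro!: derivative_eq_intros simp: field_simps power3_eq_cube power2_eq_square)
      have "1/2 * F' ((norm (p - 0))\<^sup>2 / 2) * (p \<bullet> (p - 0))
        \<le> (\<Sum>a\<in>UNIV. (- \<epsilon> / (norm p) ^ 3) * (e a \<bullet> (p - 0))\<^sup>2 + F' ((norm (p - 0))\<^sup>2 / 2) * (norm (e a))\<^sup>2)"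
      proof (rule radial_comparison[OF e p0 _ _ dF])
        show "norm p - R > 0" using pR' by simp
        show "(F' has_real_derivative - \<epsilon> / norm p ^ 3) (at ((norm (p - 0))\<^sup>2 / 2))"
          using dF'[of "(norm p)\<^sup>2 / 2"] np unfolding sqrt_norm by simp
        fix y assume "y \<in> ball p (norm p - R)"
        then have "norm y \<ge> R"
          using norm_triangle_ineq2[of p y] by (simp add: dist_norm)
        then show "\<phi> p + F ((norm (p - 0))\<^sup>2 / 2) \<le> \<phi> y + F ((norm (y - 0))\<^sup>2 / 2)"
          using pmin[of y] by (simp only: diff_zero F_def sqrt_norm G_def)
      qed
      then have main: "1/2 * (\<epsilon> / norm p) * (p \<bullet> p)
        \<le> (\<Sum>a\<in>UNIV. (\<epsilon> / norm p) * ((norm (e a))\<^sup>2 - (e a \<bullet> p)\<^sup>2 / (norm p)\<^sup>2))"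
        using np by (simp add: F'_def algebra_simps power3_eq_cube power2_eq_square)
      have "(\<epsilon> / norm p) * (1/2 * (norm p)\<^sup>2)
        \<le> (\<epsilon> / norm p) * (\<Sum>a\<in>UNIV. (norm (e a))\<^sup>2 - (e a \<bullet> p)\<^sup>2 / (norm p)\<^sup>2)"
        using main by (simp add: sum_distrib_left power2_norm_eq_inner)
      then have main': "1/2 * (norm p)\<^sup>2 \<le> (\<Sum>a\<in>UNIV. (norm (e a))\<^sup>2 - (e a \<bullet> p)\<^sup>2 / (norm p)\<^sup>2)"
        using \<epsilon> np by (simp only: mult_le_cancel_left_pos divide_pos_pos)
      have "(norm (e i0))\<^sup>2 - (e i0 \<bullet> p)\<^sup>2 / (norm p)\<^sup>2 = 0"
        using np unfolding e0 c_def[symmetric]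
        by (simp add: power2_norm_eq_inner[symmetric] field_simps power2_eq_square power4_eq_xxxx)
      then have "(\<Sum>a\<in>UNIV. (norm (e a))\<^sup>2 - (e a \<bullet> p)\<^sup>2 / (norm p)\<^sup>2)
        = (\<Sum>a\<in>UNIV - {i0}. (norm (e a))\<^sup>2 - (e a \<bullet> p)\<^sup>2 / (norm p)\<^sup>2)"
        by (simp add: sum.remove[of UNIV i0])
      also have "\<dots> \<le> (\<Sum>a\<in>UNIV - {i0}. (norm p)\<^sup>2 / k)"
      proof (rule sum_mono)
        fix a
        have "k / (norm p)\<^sup>2 * (norm (e a))\<^sup>2 \<le> 1"
          using lower[OF pR, of "e a"] e unfolding k_def[symmetric] by (simp add: orthonormal_frame_def)
        then have "(norm (e a))\<^sup>2 \<le> (norm p)\<^sup>2 / k" using k np by (simp add: field_simps)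
        moreover have "0 \<le> (e a \<bullet> p)\<^sup>2 / (norm p)\<^sup>2" by simp
        ultimately show "(norm (e a))\<^sup>2 - (e a \<bullet> p)\<^sup>2 / (norm p)\<^sup>2 \<le> (norm p)\<^sup>2 / k" by linarith
      qed
      also have "\<dots> = (real CARD('n) - 1) * ((norm p)\<^sup>2 / k)"
        by (simp add: card_Diff_singleton of_nat_diff Suc_leI)
      finally have "1/2 * (norm p)\<^sup>2 \<le> (real CARD('n) - 1) * ((norm p)\<^sup>2 / k)"
        using main' by (rule order_trans[rotated])
      then have "1/2 * (norm p)\<^sup>2 \<le> (real CARD('n) - 1) / k * (norm p)\<^sup>2"
        by (simp only: times_divide_eq_right times_divide_eq_left)
      then have "1/2 \<le> (real CARD('n) - 1) / k"
        using np by (simp only: mult_le_cancel_right_pos zero_less_power)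
      \<comment> \<open>This contradicts k = 2 (n - 1 + \<delta>); the strict excess \<delta> is
        used exactly here.\<close>
      then have "k \<le> 2 * (real CARD('n) - 1)" using k by (simp add: field_simps)
      then show False using \<delta> by (simp add: k_def)
    qed
    then have "\<phi> p0 \<le> \<phi> p" by (intro p0) simp
    then show ?thesis using pmin[OF x] \<epsilon> R \<open>norm p = R\<close> unfolding G_def by (smt (verit) mult_pos_pos)
  qed
  have "\<phi> p0 \<le> \<phi> x" for x
  proof (cases "norm x \<ge> R")
    case True
    show ?thesis
    proof (rule field_le_epsilon)
      fix r :: real assume r: "r > 0"
      have nx: "norm x > 0" using True R by linarith
      \<comment> \<open>For fixed \<open>x\<close> the barrier factor r / |x| makes the error
        exactly \<open>r\<close>.\<close>
      then show "\<phi> p0 \<le> \<phi> x + r" using outside[of "r / norm x" x] r True by simp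
    qed
  next
    case False
    then show ?thesis using p0[of x] by simp
  qed
  then have "\<phi> x = \<phi> p0" for x
    by (intro strong_minimum_principle[of UNIV]) auto
  then show ?thesis by metis
qed

end

theorem theorem1p2:
  fixes u :: "real^'n::finite \<Rightarrow> real"
  assumes "smooth u"
    and "convex_on UNIV u"
    and "\<And>x. det (hessian u x) > 0"
    and "\<And>x. ln (det (hessian u x)) = 1/2 * (x \<bullet> gradient u x) - u x"
    and "(\<exists>\<delta>>0. \<exists>R>0. \<forall>x. norm x \<ge> R \<longrightarrow>
            matrix_ge (hessian u x)
              ((2 * (real CARD('n) - 1 + \<delta>) / (norm x)\<^sup>2) *\<^sub>R mat 1))
         \<or> radially_symmetric u"
  shows "\<forall>x. u x = u 0 + 1/2 * ((hessian u 0 *v x) \<bullet> x)"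
proof
  fix x
  interpret self_shrinker u by unfold_locales (use assms in auto)
  from assms(5) have "\<phi> y = \<phi> 0" for y
  proof
    assume "\<exists>\<delta>>0. \<exists>R>0. \<forall>x. norm x \<ge> R \<longrightarrow>
      matrix_ge (hessian u x) ((2 * (real CARD('n) - 1 + \<delta>) / (norm x)\<^sup>2) *\<^sub>R mat 1)"
    then obtain \<delta> R where \<delta>R: "\<delta> > 0" "R > 0" and ge: "\<And>x. norm x \<ge> R \<Longrightarrow>
      matrix_ge (hessian u x) ((2 * (real CARD('n) - 1 + \<delta>) / (norm x)\<^sup>2) *\<^sub>R mat 1)"
      by blast
    show ?thesis
    proof (rule \<phi>_constant_if_hessian_lower_bound[OF \<delta>R])
      fix x v :: "real^'n" assume x: "norm x \<ge> R"
      show "2 * (real CARD('n) - 1 + \<delta>) / (norm x)\<^sup>2 * (norm v)\<^sup>2 \<le> v \<bullet> (hessian u x *v v)"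
        using ge[OF x] unfolding matrix_ge_def positive_semidefinite_def
        by (auto dest!: spec[of _ v] simp: matrix_vector_mult_diff_rdistrib scaleR_matrix_vector_assoc[symmetric]
            inner_diff_left inner_diff_right inner_commute power2_norm_eq_inner)
    qed
  next
    assume "radially_symmetric u"
    then show ?thesis by (rule \<phi>_constant_if_radially_symmetric)
  qed
  then show "u x = u 0 + 1/2 * ((hessian u 0 *v x) \<bullet> x)"
    by (rule quadratic_if_\<phi>_constant)
qed

end
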